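(* Let $\Gamma$ be a finite directed graph with graph inverse semigroup $\mathcal{S}(\Gamma)$. (a) Let $L$ be a closed inverse subsemigroup of $\mathcal{S}(\Gamma)$ of finite chain type. Then all closed inverse subsemigroups of $\mathcal{S}(\Gamma)$ conjugate to $L$ are of finite chain type. Two closed inverse subsemigroups $L=(u,u)^{\uparrow}$ and $K=(v,v)^{\uparrow}$ (with $u,v$ paths in $\Gamma$) are conjugate in $\mathcal{S}(\Gamma)$ if and only if they have the same root. (b) Let $L$ be a closed inverse subsemigroup of $\mathcal{S}(\Gamma)$ of infinite chain type. Then all closed inverse subsemigroups conjugate to $L$ are also of infinite chain type. Two closed inverse subsemigroups $L$ and $K$ of infinite chain type are conjugate if and only if there are idempotents $(s,s)\in L$ and $(t,t)\in K$ such that for all paths $p$ in $\Gamma$, we have $(ps,ps)\in L$ if and only if $(pt,pt)\in K$. (c) Let $L$ be a closed inverse subsemigroup of $\mathcal{S}(\Gamma)$ of cycle type. The only closed inverse subsemigroups conjugate to $L$ are of cycle type. Moreover, $L_{p,d}$ is conjugate to $L_{q,k}$ if and only if $p$ and $q$ are conjugate directed circuits in $\Gamma$.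
   Context: Paths: a path in a directed graph $\Gamma$ is a directed path; a single vertex is allowed as an empty (length zero) path. $\mathbf{d}(v)$ and $\mathbf{r}(v)$ denote the initial and terminal vertices of a path $v$. Paths are composed left to right: $pv$ is $p$ followed by $v$, defined when $\mathbf{r}(p)=\mathbf{d}(v)$. A path $v$ is a suffix of $u$ if $u=pv$ for some (possibly empty) path $p$, and a prefix of $u$ if $u=vp$ for some (possibly empty) path $p$. A directed circuit is a path of positive length whose initial and terminal vertices coincide; $p^0$ is the empty path at $\mathbf{d}(p)$. Two directed circuits $p,q$ are conjugate if there are (possibly empty) paths $u,v$ in $\Gamma$ with $p=uv$ and $q=vu$. Graph inverse semigroup: $\mathcal{S}(\Gamma)$ has underlying set $\{(v,w): v,w \text{ paths in } \Gamma,\ \mathbf{d}(v)=\mathbf{d}(w)\}\cup\{0\}$, where $0$ is a zero element, with product $$(t,u)(v,w)=\begin{cases}(t,pw) & \text{if } u=pv \text{ for a path } p,\\ (pt,w) & \text{if } v=pu \text{ for a path } p,\\ 0 & \text{otherwise.}\end{cases}$$ It is an inverse semigroup with $(v,w)^{-1}=(w,v)$. Its idempotents are $0$ and the elements $(u,u)$. Order, closure, conjugacy: in an inverse semigroup $S$ the natural partial order is $s\leq t$ iff $s=et$ for some idempotent $e$. A subset $A\subseteq S$ is closed if $a\in A$ and $a\leq s$ imply $s\in A$; for $b \in S$, $b^{\uparrow}=\{s\in S: s\geq b\}$. So $(u,u)^{\uparrow}=\{(w,w): w \text{ a suffix of } u\}$ in $\mathcal{S}(\Gamma)$. An inverse subsemigroup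 is a non-empty subset closed under products and inverses. Closed inverse subsemigroups $H,K$ of $S$ are conjugate if there exists $s\in S$ with $s^{-1}Hs\subseteq K$ and $sKs^{-1}\subseteq H$. Types of proper closed inverse subsemigroups $L$ of $\mathcal{S}(\Gamma)$: $L$ is of finite (respectively infinite) chain type if it consists of a finite (respectively infinite) chain of idempotents. A proper closed inverse subsemigroup of finite chain type has the form $(u,u)^{\uparrow}$ for a path $u$; its root is the initial vertex $\mathbf{d}(u)$. $L$ is of cycle type if $$L=L_{p,d}=\{(vp^rd,\,vp^sd): r,s\geq 0,\ v \text{ a suffix of } p\}\cup\{(q,q): q \text{ a suffix of } d\},$$ where $p$ is a directed circuit in $\Gamma$, $d$ is a path starting at the initial vertex of $p$, and $p,d$ do not share a prefix of positive length. Whenever $L_{p,d}$ is written, $p$ and $d$ are assumed to satisfy these conditions. In part (b), "$(ps,ps)\in L$" is understood to mean that the path $ps$ is defined and $(ps,ps)\in L$; similarly for $(pt,pt)\in K$. *)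

theory Defs
  imports "Graph_Theory.Arc_Walk" "HOL-Algebra.Congruence"
begin

section \<open>Inverse semigroups: order, closure, conjugacy\<close>

record 's inv_semigroup = "'s partial_object" +
  sg_mult :: "'s \<Rightarrow> 's \<Rightarrow> 's"
  sg_inv :: "'s \<Rightarrow> 's"

definition idempotents :: "('s, 'm) inv_semigroup_scheme \<Rightarrow> 's set" where
  "idempotents S = {e \<in> carrier S. sg_mult S e e = e}"

definition nat_le :: "('s, 'm) inv_semigroup_scheme \<Rightarrow> 's \<Rightarrow> 's \<Rightarrow> bool" where
  "nat_le S s t \<longleftrightarrow> s \<in> carrier S \<and> t \<in> carrier S \<and> (\<exists>e \<in> idempotents S. s = sg_mult S e t)"

definition sg_closed :: "('s, 'm) inv_semigroup_scheme \<Rightarrow> 's set \<Rightarrow> bool" where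
  "sg_closed S A \<longleftrightarrow> A \<subseteq> carrier S \<and> (\<forall>a\<in>A. \<forall>s\<in>carrier S. nat_le S a s \<longrightarrow> s \<in> A)"

definition up_set :: "('s, 'm) inv_semigroup_scheme \<Rightarrow> 's \<Rightarrow> 's set" where
  "up_set S b = {s \<in> carrier S. nat_le S b s}"

definition inverse_subsemigroup :: "('s, 'm) inv_semigroup_scheme \<Rightarrow> 's set \<Rightarrow> bool" where
  "inverse_subsemigroup S A \<longleftrightarrow> A \<subseteq> carrier S \<and> A \<noteq> {} \<and>
     (\<forall>a\<in>A. \<forall>b\<in>A. sg_mult S a b \<in> A) \<and> (\<forall>a\<in>A. sg_inv S a \<in> A)"

definition closed_inverse_subsemigroup :: "('s, 'm) inv_semigroup_scheme \<Rightarrow> 's set \<Rightarrow> bool" where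
  "closed_inverse_subsemigroup S A \<longleftrightarrow> inverse_subsemigroup S A \<and> sg_closed S A"

definition proper_closed_inverse_subsemigroup ::
    "('s, 'm) inv_semigroup_scheme \<Rightarrow> 's set \<Rightarrow> bool" where
  "proper_closed_inverse_subsemigroup S A \<longleftrightarrow>
     closed_inverse_subsemigroup S A \<and> A \<noteq> carrier S"

definition sg_conjugate :: "('s, 'm) inv_semigroup_scheme \<Rightarrow> 's set \<Rightarrow> 's set \<Rightarrow> bool" where
  "sg_conjugate S H K \<longleftrightarrow> (\<exists>s \<in> carrier S.
     (\<forall>h\<in>H. sg_mult S (sg_mult S (sg_inv S s) h) s \<in> K) \<and>
     (\<forall>k\<in>K. sg_mult S (sg_mult S s k) (sg_inv S s) \<in> H))"

definition idempotent_chain :: "('s, 'm) inv_semigroup_scheme \<Rightarrow> 's set \<Rightarrow> bool" where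
  "idempotent_chain S A \<longleftrightarrow>
     A \<subseteq> idempotents S \<and> (\<forall>a\<in>A. \<forall>b\<in>A. nat_le S a b \<or> nat_le S b a)"

definition finite_chain_type :: "('s, 'm) inv_semigroup_scheme \<Rightarrow> 's set \<Rightarrow> bool" where
  "finite_chain_type S L \<longleftrightarrow>
     proper_closed_inverse_subsemigroup S L \<and> idempotent_chain S L \<and> finite L"

definition infinite_chain_type :: "('s, 'm) inv_semigroup_scheme \<Rightarrow> 's set \<Rightarrow> bool" where
  "infinite_chain_type S L \<longleftrightarrow>
     proper_closed_inverse_subsemigroup S L \<and> idempotent_chain S L \<and> infinite L"


section \<open>Paths in a directed graph\<close>

text \<open>
  A path is an arc walk together with its initial vertex, so that every vertex carries its own
  empty path. Loops and multiple arcs are allowed.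
\<close>

type_synonym ('a, 'b) dpath = "'a \<times> 'b awalk"

definition paths :: "('a, 'b) pre_digraph \<Rightarrow> ('a, 'b) dpath set" where
  "paths G = {v. \<exists>y. pre_digraph.awalk G (fst v) (snd v) y}"

definition pdom :: "('a, 'b) dpath \<Rightarrow> 'a" where
  "pdom v = fst v"

definition pran :: "('a, 'b) pre_digraph \<Rightarrow> ('a, 'b) dpath \<Rightarrow> 'a" where
  "pran G v = pre_digraph.awlast G (fst v) (snd v)"

definition plength :: "('a, 'b) dpath \<Rightarrow> nat" where
  "plength v = length (snd v)"

text \<open>Concatenation is meaningful only if \<open>pran G p = pdom v\<close>.\<close>

definition pcomp :: "('a, 'b) dpath \<Rightarrow> ('a, 'b) dpath \<Rightarrow> ('a, 'b) dpath" where
  "pcomp p v = (fst p, snd p @ snd v)"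

text \<open>\<open>factors G u p v\<close>: the composite \<open>pv\<close> is defined and equals \<open>u\<close>.\<close>

definition factors ::
    "('a, 'b) pre_digraph \<Rightarrow> ('a, 'b) dpath \<Rightarrow> ('a, 'b) dpath \<Rightarrow> ('a, 'b) dpath \<Rightarrow> bool" where
  "factors G u p v \<longleftrightarrow> p \<in> paths G \<and> v \<in> paths G \<and> pran G p = pdom v \<and> u = pcomp p v"

definition psuffix :: "('a, 'b) pre_digraph \<Rightarrow> ('a, 'b) dpath \<Rightarrow> ('a, 'b) dpath \<Rightarrow> bool" where
  "psuffix G v u \<longleftrightarrow> (\<exists>p. factors G u p v)"

definition pprefix :: "('a, 'b) pre_digraph \<Rightarrow> ('a, 'b) dpath \<Rightarrow> ('a, 'b) dpath \<Rightarrow> bool" where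
  "pprefix G v u \<longleftrightarrow> (\<exists>p. factors G u v p)"

definition circuit :: "('a, 'b) pre_digraph \<Rightarrow> ('a, 'b) dpath \<Rightarrow> bool" where
  "circuit G p \<longleftrightarrow> p \<in> paths G \<and> plength p > 0 \<and> pdom p = pran G p"

primrec ppow :: "('a, 'b) dpath \<Rightarrow> nat \<Rightarrow> ('a, 'b) dpath" where
  "ppow p 0 = (pdom p, [])"
| "ppow p (Suc n) = pcomp p (ppow p n)"

definition conjugate_circuits ::
    "('a, 'b) pre_digraph \<Rightarrow> ('a, 'b) dpath \<Rightarrow> ('a, 'b) dpath \<Rightarrow> bool" where
  "conjugate_circuits G p q \<longleftrightarrow>
     circuit G p \<and> circuit G q \<and> (\<exists>u v. factors G p u v \<and> factors G q v u)"


section \<open>The graph inverse semigroup\<close>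

datatype ('a, 'b) gis = Zero | Elt "('a, 'b) dpath" "('a, 'b) dpath"

definition gis_carrier :: "('a, 'b) pre_digraph \<Rightarrow> ('a, 'b) gis set" where
  "gis_carrier G = {Elt v w | v w. v \<in> paths G \<and> w \<in> paths G \<and> pdom v = pdom w} \<union> {Zero}"

text \<open>
  In each of the first two cases the path \<open>p\<close> is unique; if both apply, \<open>p\<close> is empty and the
  two values agree.
\<close>

fun gis_mult :: "('a, 'b) pre_digraph \<Rightarrow> ('a, 'b) gis \<Rightarrow> ('a, 'b) gis \<Rightarrow> ('a, 'b) gis" where
  "gis_mult G (Elt t u) (Elt v w) =
     (if \<exists>p. factors G u p v then Elt t (pcomp (THE p. factors G u p v) w)
      else if \<exists>p. factors G v p u then Elt (pcomp (THE p. factors G v p u) t) w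
      else Zero)"
| "gis_mult G Zero y = Zero"
| "gis_mult G x Zero = Zero"

fun gis_inv :: "('a, 'b) gis \<Rightarrow> ('a, 'b) gis" where
  "gis_inv (Elt v w) = Elt w v"
| "gis_inv Zero = Zero"

definition graph_inverse_semigroup :: "('a, 'b) pre_digraph \<Rightarrow> ('a, 'b) gis inv_semigroup" where
  "graph_inverse_semigroup G =
     \<lparr>carrier = gis_carrier G, sg_mult = gis_mult G, sg_inv = gis_inv\<rparr>"

abbreviation up_path :: "('a, 'b) pre_digraph \<Rightarrow> ('a, 'b) dpath \<Rightarrow> ('a, 'b) gis set" where
  "up_path G u \<equiv> up_set (graph_inverse_semigroup G) (Elt u u)"

text \<open>The root is the initial vertex of the path \<open>u\<close> with \<open>L = up_path G u\<close>, which is unique.\<close>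

definition chain_root :: "('a, 'b) pre_digraph \<Rightarrow> ('a, 'b) gis set \<Rightarrow> 'a" where
  "chain_root G L = pdom (THE u. u \<in> paths G \<and> L = up_path G u)"

definition cycle_data :: "('a, 'b) pre_digraph \<Rightarrow> ('a, 'b) dpath \<Rightarrow> ('a, 'b) dpath \<Rightarrow> bool" where
  "cycle_data G p d \<longleftrightarrow> circuit G p \<and> d \<in> paths G \<and> pdom d = pdom p \<and>
     \<not> (\<exists>w. plength w > 0 \<and> pprefix G w p \<and> pprefix G w d)"

definition cycle_subsemigroup ::
    "('a, 'b) pre_digraph \<Rightarrow> ('a, 'b) dpath \<Rightarrow> ('a, 'b) dpath \<Rightarrow> ('a, 'b) gis set" where
  "cycle_subsemigroup G p d =
     {Elt (pcomp v (pcomp (ppow p r) d)) (pcomp v (pcomp (ppow p s) d)) | v r s. psuffix G v p}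
     \<union> {Elt q q | q. psuffix G q d}"

definition cycle_type :: "('a, 'b) pre_digraph \<Rightarrow> ('a, 'b) gis set \<Rightarrow> bool" where
  "cycle_type G L \<longleftrightarrow>
     proper_closed_inverse_subsemigroup (graph_inverse_semigroup G) L \<and>
     (\<exists>p d. cycle_data G p d \<and> L = cycle_subsemigroup G p d)"

end

theory Submission
  imports Defs
begin

text \<open>
  A closed inverse subsemigroup \<open>H\<close> is proper iff it omits zero. If \<open>(a, b)\<close> conjugates \<open>H\<close> to \<open>K\<close>,
  then \<open>(a, a) \<in> H\<close>, \<open>(b, b) \<in> K\<close>, and \<open>(xa, ya) \<in> H \<longleftrightarrow> (xb, yb) \<in> K\<close>; since every element of
  \<open>H\<close> lies above one of the form \<open>(xa, ya) \<in> H\<close>, this determines \<open>K\<close> from \<open>H\<close>.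
  Parts (a) and (b) follow directly. For (c), \<open>L\<^bsub>p,d\<^esub>\<close> is the upward closure of
  \<open>{(p\<^sup>r d, p\<^sup>s d)}\<close>. This closure makes sense even when \<open>p = uv\<close> and \<open>d = ud'\<close> share the prefix \<open>u\<close>,
  and is then unchanged when \<open>(p, d)\<close> is replaced by \<open>(vu, d')\<close>; conjugation only replaces \<open>d\<close>.
  If two such closures coincide, comparing lengths gives \<open>|p| = |q|\<close> and \<open>qe = ep\<close> for some path \<open>e\<close>,
  so that \<open>p\<close> and \<open>q\<close> are conjugate.
\<close>

text \<open>Paths are pairs; these rules would break quantified paths into a vertex and an arc list,
  out of reach of the rules for \<open>pcomp\<close>, \<open>pdom\<close> and
  \<open>pran\<close>.\<close>

declare split_paired_Ex [simp del] split_paired_All [simp del]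

section \<open>Paths\<close>

lemma fst_pcomp [simp]: "fst (pcomp a b) = fst a"
  and snd_pcomp [simp]: "snd (pcomp a b) = snd a @ snd b"
  by (simp_all add: pcomp_def)

lemma pdom_pcomp [simp]: "pdom (pcomp a b) = pdom a"
  by (simp add: pdom_def)

lemma plength_pcomp [simp]: "plength (pcomp a b) = plength a + plength b"
  by (simp add: plength_def)

lemma pcomp_assoc [simp]: "pcomp (pcomp a b) c = pcomp a (pcomp b c)"
  by (simp add: pcomp_def)

lemma pcomp_right_cancel [simp]: "pcomp a c = pcomp b c \<longleftrightarrow> a = b"
  by (auto simp: pcomp_def prod_eq_iff)

text \<open>\<open>pcomp\<close> forgets the initial vertex of its second factor, so left
  cancellation must be told that these vertices agree.\<close>

lemma pcomp_left_cancel: "pcomp a b = pcomp a c \<Longrightarrow> pdom b = pdom c \<Longrightarrow> b = c"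
  by (auto simp: pcomp_def pdom_def prod_eq_iff)

lemma pcomp_empty_left: "plength a = 0 \<Longrightarrow> pdom a = pdom b \<Longrightarrow> pcomp a b = b"
  by (auto simp: pcomp_def pdom_def plength_def prod_eq_iff)

lemma pdom_Pair [simp]: "pdom (x, l) = x"
  by (simp add: pdom_def)

lemma plength_empty [simp]: "plength (x, []) = 0"
  by (simp add: plength_def)

lemma pcomp_empty [simp]: "x = pdom b \<Longrightarrow> pcomp (x, []) b = b"
  by (simp add: pcomp_empty_left)

lemma pcomp_empty_right: "plength b = 0 \<Longrightarrow> pcomp a b = a"
  by (auto simp: pcomp_def plength_def prod_eq_iff)

section \<open>Powers of a path\<close>

lemma ppow_add: "ppow p (m + n) = pcomp (ppow p m) (ppow p n)"
proof (induction m)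
  case 0
  have "pdom (ppow p n) = pdom p" by (cases n) (auto simp: pdom_def)
  then show ?case by (simp add: pcomp_def pdom_def prod_eq_iff)
qed simp

lemma pdom_ppow [simp]: "pdom (ppow p n) = pdom p"
  by (cases n) (auto simp: pdom_def)

lemma plength_ppow [simp]: "plength (ppow p n) = n * plength p"
  by (induction n) (auto simp: plength_def)

lemma ppow_add_pcomp: "pcomp (ppow p m) (pcomp (ppow p n) d) = pcomp (ppow p (m + n)) d"
  by (simp add: ppow_add)

text \<open>Regrouping \<open>uvuv...u\<close> moves \<open>u\<close> past the power; this is the
  source of the rotation invariance of cycle closures.\<close>

lemma ppow_rotate: "pcomp (ppow (pcomp u v) n) u = pcomp u (ppow (pcomp v u) n)"
proof (induction n)
  case 0
  show ?case by (simp add: pcomp_def pdom_def)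
qed simp

lemma ppow_rotate_pcomp:
  "pcomp (ppow (pcomp u v) n) (pcomp u d) = pcomp u (pcomp (ppow (pcomp v u) n) d)"
  by (metis pcomp_assoc ppow_rotate)

context wf_digraph
begin

lemma pran_pcomp [simp]: "pran G a = pdom b \<Longrightarrow> pran G (pcomp a b) = pran G b"
  by (simp add: pran_def pdom_def awlast_append)

lemma mem_paths_iff: "v \<in> paths G \<longleftrightarrow> awalk (fst v) (snd v) (pran G v)"
  by (auto simp: paths_def pran_def)

lemma pcomp_paths [simp]:
  "a \<in> paths G \<Longrightarrow> b \<in> paths G \<Longrightarrow> pran G a = pdom b \<Longrightarrow> pcomp a b \<in> paths G"
  by (auto simp: mem_paths_iff pran_def pdom_def awlast_append)

lemma plength_0_pran: "plength a = 0 \<Longrightarrow> pran G a = pdom a"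
  by (simp add: plength_def pran_def pdom_def)

lemma empty_path: "a \<in> paths G \<Longrightarrow> (pdom a, []) \<in> paths G"
  by (auto simp: mem_paths_iff pdom_def pran_def awalk_def)

text \<open>Products are evaluated by \<open>gis_mult_left\<close> and \<open>gis_mult_right\<close>
  below, which hide the definite descriptions.\<close>

declare gis_mult.simps(1) [simp del]

lemma pran_empty [simp]: "pran G (x, []) = x"
  by (simp add: pran_def)

text \<open>Levi's lemma in the free category on the graph: the shorter left factor is a prefix of
  the longer one, and the overlap \<open>h\<close> both completes \<open>a\<close> to
  \<open>c\<close> and starts \<open>b\<close>.\<close>

lemma levi:
  assumes "a \<in> paths G" "b \<in> paths G" "pran G a = pdom b"
    and "c \<in> paths G" "d \<in> paths G" "pran G c = pdom d"
    and eq: "pcomp a b = pcomp c d" and le: "plength a \<le> plength c"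
  obtains h where "h \<in> paths G" "pran G a = pdom h" "pran G h = pdom d"
    "c = pcomp a h" "b = pcomp h d"
proof -
  have f: "fst a = fst c" and s: "snd a @ snd b = snd c @ snd d"
    using eq by (auto simp: pcomp_def)
  define us where "us = drop (length (snd a)) (snd c)"
  have us: "snd c = snd a @ us"
  proof -
    have "snd a = take (length (snd a)) (snd c)"
      using arg_cong[OF s, of "take (length (snd a))"] le by (simp add: plength_def)
    moreover have "snd c = take (length (snd a)) (snd c) @ us" by (simp add: us_def)
    ultimately show ?thesis by (rule ssubst)
  qed
  then have us': "snd b = us @ snd d" using s by simp
  \<comment> \<open>Starting \<open>h\<close> at the end of \<open>a\<close> makes it a composable
    path even when it has no arcs.\<close>
  let ?h = "(pran G a, us)"
  have "awalk (fst c) (snd c) (pran G c)" using assms(4) by (simp add: mem_paths_iff)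
  then have w: "awalk (pran G a) us (pran G c)" using us f by (simp add: pran_def)
  then have h: "?h \<in> paths G" by (auto simp: paths_def)
  have r: "pran G ?h = pran G c" using w by (auto simp: pran_def)
  have c: "c = pcomp a ?h" by (rule prod_eqI) (use us f in simp_all)
  have b: "b = pcomp ?h d" by (rule prod_eqI) (use us' assms(3) in \<open>simp_all add: pdom_def\<close>)
  have "pran G a = pdom ?h" by simp
  moreover have "pran G ?h = pdom d" using r assms(6) by (rule trans)
  ultimately show thesis using c b by (rule that[OF h])
qed

lemma levi_cases:
  assumes "a \<in> paths G" "b \<in> paths G" "pran G a = pdom b"
    and "c \<in> paths G" "d \<in> paths G" "pran G c = pdom d"
    and eq: "pcomp a b = pcomp c d"
  obtains h where "h \<in> paths G" "pran G a = pdom h" "pran G h = pdom d"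
      "c = pcomp a h" "b = pcomp h d"
  | h where "h \<in> paths G" "pran G c = pdom h" "pran G h = pdom b"
      "a = pcomp c h" "d = pcomp h b"
proof (cases "plength a \<le> plength c")
  case True
  then show thesis using levi[OF assms] that(1) by blast
next
  case False
  then have "plength c \<le> plength a" by simp
  from levi[OF assms(4-6) assms(1-3) eq[symmetric] this] that(2) show thesis by blast
qed

section \<open>Circuits and their conjugacy\<close>

lemma circuit_paths: "circuit G p \<Longrightarrow> p \<in> paths G"
  and circuit_pran [simp]: "circuit G p \<Longrightarrow> pran G p = pdom p"
  and circuit_plength: "circuit G p \<Longrightarrow> 0 < plength p"
  by (auto simp: circuit_def)

lemma pran_ppow [simp]: "circuit G p \<Longrightarrow> pran G (ppow p n) = pdom p"
  by (induction n) (auto)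

lemma ppow_paths [simp]: "circuit G p \<Longrightarrow> ppow p n \<in> paths G"
  by (induction n) (auto simp: circuit_paths empty_path)

lemma circuit_rotate:
  assumes "circuit G (pcomp x y)" "x \<in> paths G" "y \<in> paths G" "pran G x = pdom y"
  shows "circuit G (pcomp y x)"
  using assms by (auto simp: circuit_def)

text \<open>The solutions of \<open>qe = ep\<close> in a free category: \<open>e = q\<^sup>n u\<close> with \<open>q = uv\<close> and \<open>p = vu\<close>.\<close>

lemma intertwined_circuits_conjugate:
  assumes "circuit G p" "circuit G q" "e \<in> paths G" "pran G q = pdom e" "pran G e = pdom p"
    and "pcomp q e = pcomp e p"
  shows "conjugate_circuits G p q"
  using assms(3-)
proof (induction "plength e" arbitrary: e rule: less_induct)
  case less
  note p = circuit_paths[OF assms(1)] and q = circuit_paths[OF assms(2)]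
  show ?case
  proof (cases "plength q \<le> plength e")
    \<comment> \<open>A leading copy of \<open>q\<close> splits off: \<open>e = qh = hp\<close>, so
      \<open>h\<close> is a strictly shorter solution of the same equation.\<close>
    case True
    from levi[OF q less.prems(1,2) less.prems(1) p less.prems(3,4) True]
    obtain h where h: "h \<in> paths G" "pran G q = pdom h" "pran G h = pdom p"
      "e = pcomp q h" "e = pcomp h p" by metis
    show ?thesis
      by (rule less.hyps[OF _ h(1-3)])
        (use h(4,5) circuit_plength[OF assms(2)] in auto)
  next
    \<comment> \<open>Here \<open>e\<close> is a prefix of \<open>q\<close>, and Levi's lemma
      exhibits the rotation directly: \<open>q = eh\<close> and \<open>p = he\<close>.\<close>
    case False
    then have le: "plength e \<le> plength q" by simp
    from levi[OF less.prems(1) p less.prems(3) q less.prems(1,2) less.prems(4)[symmetric] le]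
    obtain h where h: "h \<in> paths G" "pran G e = pdom h" "pran G h = pdom e"
      "q = pcomp e h" "p = pcomp h e" by metis
    then show ?thesis
      using assms(1,2) less.prems(1) unfolding conjugate_circuits_def factors_def by metis
  qed
qed

section \<open>Closed inverse subsemigroups without zero\<close>

text \<open>The path picked by \<open>THE\<close> is \<open>p\<close>, because \<open>p\<close> can
  be recovered from \<open>pv\<close> by right cancellation.\<close>

lemma gis_mult_left:
  assumes "p \<in> paths G" "v \<in> paths G" "pran G p = pdom v"
  shows "gis_mult G (Elt t (pcomp p v)) (Elt v w) = Elt t (pcomp p w)"
proof -
  have "factors G (pcomp p v) p v" using assms by (simp add: factors_def)
  moreover from this have "(THE p'. factors G (pcomp p v) p' v) = p"
    by (rule the_equality) (auto simp: factors_def)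
  ultimately show ?thesis unfolding gis_mult.simps by metis
qed

lemma gis_mult_right:
  assumes "p \<in> paths G" "u \<in> paths G" "pran G p = pdom u" "pdom t = pdom u" "pdom w = pdom p"
  shows "gis_mult G (Elt t u) (Elt (pcomp p u) w) = Elt (pcomp p t) w"
\<comment> \<open>The definition tests the other branch first. If it applies as well, comparing
  lengths makes \<open>p\<close> empty and both branches give the same value.\<close>
proof (cases "\<exists>p'. factors G u p' (pcomp p u)")
  case True
  then obtain p' where p': "factors G u p' (pcomp p u)" ..
  then have "plength u = plength p' + (plength p + plength u)"
    unfolding factors_def by (metis plength_pcomp)
  then have 0: "plength p = 0" by simp
  then have *: "pcomp p u = u" "pcomp p t = t"
    using assms plength_0_pran by (auto intro!: pcomp_empty_left)
  have "gis_mult G (Elt t (pcomp (pdom u, []) u)) (Elt u w) = Elt t (pcomp (pdom u, []) w)"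
    using assms by (intro gis_mult_left) (auto simp: empty_path)
  then show ?thesis
    using * assms 0 plength_0_pran[OF 0]
    by (simp add: pcomp_empty_left plength_def pdom_def)
next
  case False
  have "factors G (pcomp p u) p u" using assms by (simp add: factors_def)
  moreover from this have "(THE p'. factors G (pcomp p u) p' u) = p"
    by (rule the_equality) (auto simp: factors_def)
  ultimately show ?thesis using False unfolding gis_mult.simps by metis
qed

lemma gis_mult_cases:
  assumes "gis_mult G (Elt t u) (Elt v w) \<noteq> Zero"
  obtains p where "p \<in> paths G" "v \<in> paths G" "pran G p = pdom v" "u = pcomp p v"
  | p where "p \<in> paths G" "u \<in> paths G" "pran G p = pdom u" "v = pcomp p u"
proof -
  have "(\<exists>p. factors G u p v) \<or> (\<exists>p. factors G v p u)"
    using assms unfolding gis_mult.simps by presburger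
  then show thesis using that unfolding factors_def by blast
qed

abbreviation gis where "gis \<equiv> graph_inverse_semigroup G"

lemma gis_simps [simp]:
  "carrier gis = gis_carrier G" "sg_mult gis = gis_mult G" "sg_inv gis = gis_inv"
  by (simp_all add: graph_inverse_semigroup_def)

lemma gis_mult_Zero_right [simp]: "gis_mult G x Zero = Zero"
  by (cases x) simp_all

lemma Zero_carrier [simp]: "Zero \<in> gis_carrier G"
  by (simp add: gis_carrier_def)

lemma Elt_carrier [simp]:
  "Elt v w \<in> gis_carrier G \<longleftrightarrow> v \<in> paths G \<and> w \<in> paths G \<and> pdom v = pdom w"
  unfolding gis_carrier_def by blast

lemma carrier_cases:
  assumes "h \<in> gis_carrier G"
  obtains "h = Zero"
  | v w where "h = Elt v w" "v \<in> paths G" "w \<in> paths G" "pdom v = pdom w"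
  using assms by (auto simp: gis_carrier_def)

section \<open>Idempotents and the natural order\<close>

lemma pcomp_eq_right_iff: "pcomp p v = v \<longleftrightarrow> plength p = 0 \<and> pdom p = pdom v"
  by (metis add_cancel_left_left pcomp_empty_left pdom_pcomp plength_pcomp)

lemma gis_mult_idem: "u \<in> paths G \<Longrightarrow> gis_mult G (Elt u u) (Elt u u) = Elt u u"
  using gis_mult_left[of "(pdom u, [])" u u u]
  by (simp add: empty_path)

text \<open>A non-zero square of \<open>(u,v)\<close> makes one of \<open>u\<close>,
  \<open>v\<close> a suffix of the other; comparing the square with \<open>(u,v)\<close> makes the
  extra prefix empty.\<close>

lemma Elt_idempotents_iff: "Elt u v \<in> idempotents gis \<longleftrightarrow> u = v \<and> u \<in> paths G"
proof
  assume "Elt u v \<in> idempotents gis"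
  then have c: "u \<in> paths G" "v \<in> paths G" "pdom u = pdom v"
    and m: "gis_mult G (Elt u v) (Elt u v) = Elt u v"
    by (auto simp: idempotents_def)
  from m have "gis_mult G (Elt u v) (Elt u v) \<noteq> Zero" by simp
  then show "u = v \<and> u \<in> paths G"
  proof (cases rule: gis_mult_cases)
    case (1 p)
    have "gis_mult G (Elt u v) (Elt u v) = Elt u (pcomp p v)"
      using gis_mult_left[OF 1(1-3)] by (simp flip: 1(4))
    then have "pcomp p v = v" using m by simp
    then have "pcomp p u = u" using c(3) by (simp add: pcomp_eq_right_iff)
    then show ?thesis using 1(4) c(1) by simp
  next
    case (2 p)
    have "gis_mult G (Elt u v) (Elt u v) = Elt (pcomp p u) v"
      using gis_mult_right[OF 2(1-3) c(3)] 2(4) by (metis pdom_pcomp c(3))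
    then have "pcomp p u = u" using m by simp
    then have "pcomp p v = v" using c(3) by (simp add: pcomp_eq_right_iff)
    then show ?thesis using 2(4) c(1) by simp
  qed
next
  assume "u = v \<and> u \<in> paths G"
  then show "Elt u v \<in> idempotents gis" by (auto simp: idempotents_def gis_mult_idem)
qed

lemma Zero_idempotent: "Zero \<in> idempotents gis"
  by (simp add: idempotents_def)

lemma nat_le_Zero: "s \<in> gis_carrier G \<Longrightarrow> nat_le gis Zero s"
  by (auto simp: nat_le_def intro!: bexI[of _ Zero] Zero_idempotent)

text \<open>Left multiplication by an idempotent \<open>(u,u)\<close> that does not give zero either
  fixes \<open>(v,w)\<close> or puts one prefix in front of both \<open>v\<close> and
  \<open>w\<close>. Going up in the order thus strips a common prefix.\<close>

lemma nat_le_Elt_iff: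
  "nat_le gis (Elt x y) (Elt v w) \<longleftrightarrow> v \<in> paths G \<and> w \<in> paths G \<and> pdom v = pdom w \<and>
     (\<exists>q \<in> paths G. pran G q = pdom v \<and> x = pcomp q v \<and> y = pcomp q w)"
  (is "?l \<longleftrightarrow> ?r")
proof
  assume ?l
  then obtain e where c: "v \<in> paths G" "w \<in> paths G" "pdom v = pdom w" "pdom x = pdom y"
    "e \<in> idempotents gis" and m: "Elt x y = gis_mult G e (Elt v w)"
    by (auto simp: nat_le_def)
  obtain u u' where "e = Elt u u'" using m by (cases e) auto
  with c have u: "e = Elt u u" "u \<in> paths G" by (auto simp: Elt_idempotents_iff)
  from m u(1) have "gis_mult G (Elt u u) (Elt v w) \<noteq> Zero" by (metis gis.distinct(1))
  then show ?r
  proof (cases rule: gis_mult_cases)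
    case (1 p)
    then show ?thesis using m u c gis_mult_left[of p v u w] by auto
  next
    case (2 p)
    \<comment> \<open>Here \<open>u\<close> is a suffix of \<open>v\<close>, the product is
      \<open>(v,w)\<close> itself, and the common prefix is empty.\<close>
    let ?e = "(pdom v, [])"
    have "pcomp ?e v = v" "pcomp ?e w = w"
      using c by simp_all
    then show ?thesis
      using 2 m u c gis_mult_right[of p u u w]
      by (auto intro!: bexI[of _ ?e] simp: empty_path)
  qed
next
  assume ?r
  then obtain q where q: "v \<in> paths G" "w \<in> paths G" "pdom v = pdom w"
     "q \<in> paths G" "pran G q = pdom v" "x = pcomp q v" "y = pcomp q w" by auto
  moreover from q have "Elt x y = gis_mult G (Elt x x) (Elt v w)"
    by (simp add: gis_mult_left)
  moreover from q have "Elt x x \<in> idempotents gis" by (simp add: Elt_idempotents_iff)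
  ultimately show ?l unfolding nat_le_def gis_simps Elt_carrier by (metis pcomp_paths pdom_pcomp)
qed

definition zero_free :: "('a, 'b) gis set \<Rightarrow> bool" where
  "zero_free H \<longleftrightarrow> closed_inverse_subsemigroup gis H \<and> Zero \<notin> H"

text \<open>Zero is the least element, so a closed set that contains it is the whole
  semigroup.\<close>

lemma proper_iff_zero_free: "proper_closed_inverse_subsemigroup gis H \<longleftrightarrow> zero_free H"
proof -
  have "H = gis_carrier G" if "closed_inverse_subsemigroup gis H" "Zero \<in> H"
    using that nat_le_Zero
    by (auto simp: closed_inverse_subsemigroup_def sg_closed_def)
  then show ?thesis
    by (auto simp: proper_closed_inverse_subsemigroup_def zero_free_def)
qed

lemma zero_free_cases:
  assumes "zero_free H" "h \<in> H"
  obtains v w where "h = Elt v w" "v \<in> paths G" "w \<in> paths G" "pdom v = pdom w"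
proof -
  have "h \<in> gis_carrier G" "h \<noteq> Zero"
    using assms by (auto simp: zero_free_def closed_inverse_subsemigroup_def sg_closed_def)
  then show thesis using that by (cases rule: carrier_cases) auto
qed

lemma zero_free_Elt:
  assumes "zero_free H" "Elt v w \<in> H"
  shows "v \<in> paths G" "w \<in> paths G" "pdom v = pdom w"
  using zero_free_cases[OF assms] by auto

lemma zero_free_up:
  assumes "zero_free H" "Elt (pcomp q v) (pcomp q w) \<in> H" "q \<in> paths G" "v \<in> paths G"
    "w \<in> paths G" "pran G q = pdom v" "pdom v = pdom w"
  shows "Elt v w \<in> H"
proof -
  have "nat_le gis (Elt (pcomp q v) (pcomp q w)) (Elt v w)"
    using assms by (auto simp: nat_le_Elt_iff)
  then show ?thesis
    using assms unfolding zero_free_def closed_inverse_subsemigroup_def sg_closed_def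
    by (metis Elt_carrier gis_simps(1))
qed

lemma zero_free_mult: "zero_free H \<Longrightarrow> h \<in> H \<Longrightarrow> k \<in> H \<Longrightarrow> gis_mult G h k \<in> H"
  by (simp add: zero_free_def closed_inverse_subsemigroup_def inverse_subsemigroup_def)

lemma zero_free_inv: "zero_free H \<Longrightarrow> Elt v w \<in> H \<Longrightarrow> Elt w v \<in> H"
  unfolding zero_free_def closed_inverse_subsemigroup_def inverse_subsemigroup_def
  by (metis gis_inv.simps(1) gis_simps(3))

lemma zero_free_nonempty: "zero_free H \<Longrightarrow> \<exists>h. h \<in> H"
  by (auto simp: zero_free_def closed_inverse_subsemigroup_def inverse_subsemigroup_def)

text \<open>A product of members is a member and hence non-zero, so the two inner coordinates must
  be comparable as suffixes. This comparability drives most of the later arguments.\<close>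

lemma zero_free_mult_cases:
  assumes "zero_free H" "Elt t u \<in> H" "Elt v w \<in> H"
  obtains p where "p \<in> paths G" "v \<in> paths G" "pran G p = pdom v" "u = pcomp p v"
    "Elt t (pcomp p w) \<in> H"
  | p where "p \<in> paths G" "u \<in> paths G" "pran G p = pdom u" "v = pcomp p u"
    "Elt (pcomp p t) w \<in> H"
proof -
  have m: "gis_mult G (Elt t u) (Elt v w) \<in> H" using assms by (simp add: zero_free_mult)
  then have "gis_mult G (Elt t u) (Elt v w) \<noteq> Zero" using assms(1) by (metis zero_free_def)
  then show thesis
  proof (cases rule: gis_mult_cases)
    case (1 p)
    then show thesis using m that(1) gis_mult_left[of p v t w] by simp
  next
    case (2 p)
    then show thesis using m that(2) gis_mult_right[of p u t w]
       zero_free_Elt[OF assms(1,2)] zero_free_Elt[OF assms(1,3)] by simp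
  qed
qed

lemma zero_free_diag:
  assumes "zero_free H" "Elt v w \<in> H"
  shows "Elt v v \<in> H"
proof -
  have "gis_mult G (Elt v w) (Elt w v) \<in> H"
    using assms zero_free_inv zero_free_mult by blast
  \<comment> \<open>The second factor is written with an empty prefix on \<open>w\<close> to match
    \<open>gis_mult_right\<close>; the product is \<open>(v,v)\<close>.\<close>
  moreover have "gis_mult G (Elt v w) (Elt (pcomp (pdom w, []) w) v) = Elt (pcomp (pdom w, []) v) v"
    using zero_free_Elt[OF assms]
    by (intro gis_mult_right) (simp_all add: empty_path)
  ultimately show ?thesis
    using zero_free_Elt[OF assms]
    by simp
qed

section \<open>Conjugation\<close>

text \<open>Conjugation by \<open>(a, b)\<close> replaces the common tail \<open>a\<close> by \<open>b\<close>.\<close>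

definition conj_at ::
    "('a, 'b) dpath \<Rightarrow> ('a, 'b) dpath \<Rightarrow> ('a, 'b) gis set \<Rightarrow> ('a, 'b) gis set \<Rightarrow> bool" where
  "conj_at a b H K \<longleftrightarrow> pdom a = pdom b \<and> Elt a a \<in> H \<and> Elt b b \<in> K \<and>
     (\<forall>x \<in> paths G. \<forall>y \<in> paths G. pran G x = pdom a \<and> pran G y = pdom a \<longrightarrow>
        (Elt (pcomp x a) (pcomp y a) \<in> H \<longleftrightarrow> Elt (pcomp x b) (pcomp y b) \<in> K))"

lemma conj_at_sym: "conj_at a b H K \<Longrightarrow> conj_at b a K H"
  by (auto simp: conj_at_def)

lemma conj_atD:
  assumes "conj_at a b H K" "x \<in> paths G" "y \<in> paths G" "pran G x = pdom a" "pran G y = pdom a"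
  shows "Elt (pcomp x a) (pcomp y a) \<in> H \<longleftrightarrow> Elt (pcomp x b) (pcomp y b) \<in> K"
  using assms by (auto simp: conj_at_def)

lemma conj_mult:
  assumes "a \<in> paths G" "b \<in> paths G" "pdom a = pdom b" "x \<in> paths G" "y \<in> paths G"
    "pran G x = pdom a" "pran G y = pdom a" "pdom x = pdom y"
  shows "gis_mult G (gis_mult G (Elt b a) (Elt (pcomp x a) (pcomp y a))) (Elt a b)
    = Elt (pcomp x b) (pcomp y b)"
  using assms by (simp add: gis_mult_right gis_mult_left)

text \<open>Since \<open>(a,a)(v,w)\<close> is non-zero, \<open>a\<close> and \<open>v\<close> are
  comparable; \<open>q\<close> and \<open>x\<close> extend them to a common path, one of the two
  being empty. The last conclusion records the same computation with \<open>(b,a)\<close> in place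
  of \<open>(a,a)\<close>.\<close>

lemma tail_left:
  assumes H: "zero_free H" and a: "Elt a a \<in> H" and vw: "Elt v w \<in> H"
  obtains q x where "q \<in> paths G" "x \<in> paths G" "pran G q = pdom v" "pran G x = pdom a"
    "pcomp q v = pcomp x a" "Elt (pcomp x a) (pcomp q w) \<in> H"
    "\<And>b. pdom b = pdom a \<Longrightarrow> gis_mult G (Elt b a) (Elt v w) = Elt (pcomp x b) (pcomp q w)"
proof -
  note pa = zero_free_Elt[OF H a] and pv = zero_free_Elt[OF H vw]
  from H a vw show thesis
  proof (cases rule: zero_free_mult_cases)
    case (1 p)
    show thesis
      by (rule that[of p "(pdom a, [])"])
        (use 1 pa pv empty_path[OF pa(1)] empty_path[OF pv(2)] in \<open>auto simp: gis_mult_left\<close>)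
  next
    case (2 p)
    show thesis
      by (rule that[of "(pdom v, [])" p])
        (use 2 pa pv empty_path[OF pa(1)] empty_path[OF pv(1)] in \<open>auto simp: gis_mult_right\<close>)
  qed
qed

lemma tail_right:
  assumes H: "zero_free H" and a: "Elt a a \<in> H" and vw: "Elt v w \<in> H"
  obtains q y where "q \<in> paths G" "y \<in> paths G" "pran G q = pdom w" "pran G y = pdom a"
    "pcomp q w = pcomp y a" "Elt (pcomp q v) (pcomp y a) \<in> H"
    "\<And>b t. pdom b = pdom a \<Longrightarrow> pdom t = pdom w \<Longrightarrow>
      gis_mult G (Elt t w) (Elt a b) = Elt (pcomp q t) (pcomp y b)"
proof -
  note pa = zero_free_Elt[OF H a] and pv = zero_free_Elt[OF H vw]
  from H vw a show thesis
  proof (cases rule: zero_free_mult_cases)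
    case (1 p)
    show thesis
      by (rule that[of "(pdom w, [])" p])
        (use 1 pa pv empty_path[OF pa(1)] empty_path[OF pv(2)] in \<open>auto simp: gis_mult_left\<close>)
  next
    case (2 p)
    show thesis
      by (rule that[of p "(pdom a, [])"])
        (use 2 pa pv empty_path[OF pa(1)] empty_path[OF pv(1)] in \<open>auto simp: gis_mult_right\<close>)
  qed
qed

lemma common_tail:
  assumes H: "zero_free H" and a: "Elt a a \<in> H" and vw: "Elt v w \<in> H"
  obtains q x y where "q \<in> paths G" "x \<in> paths G" "y \<in> paths G" "pran G q = pdom v"
    "pran G x = pdom a" "pran G y = pdom a" "pcomp q v = pcomp x a" "pcomp q w = pcomp y a"
    "Elt (pcomp x a) (pcomp y a) \<in> H"
    "\<And>b. pdom b = pdom a \<Longrightarrow>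
       gis_mult G (gis_mult G (Elt b a) (Elt v w)) (Elt a b) = Elt (pcomp x b) (pcomp y b)"
proof -
  note pv = zero_free_Elt[OF H vw]
  from tail_left[OF assms] obtain q1 x where 1: "q1 \<in> paths G" "x \<in> paths G"
    "pran G q1 = pdom v" "pran G x = pdom a"
    "pcomp q1 v = pcomp x a" "Elt (pcomp x a) (pcomp q1 w) \<in> H"
    "\<And>b. pdom b = pdom a \<Longrightarrow> gis_mult G (Elt b a) (Elt v w) = Elt (pcomp x b) (pcomp q1 w)"
    by metis
  from tail_right[OF H a 1(6)] obtain q2 y where 2: "q2 \<in> paths G" "y \<in> paths G"
    "pran G q2 = pdom q1" "pran G y = pdom a"
    "pcomp q2 (pcomp q1 w) = pcomp y a" "Elt (pcomp q2 (pcomp x a)) (pcomp y a) \<in> H"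
    "\<And>b t. pdom b = pdom a \<Longrightarrow> pdom t = pdom q1 \<Longrightarrow>
      gis_mult G (Elt t (pcomp q1 w)) (Elt a b) = Elt (pcomp q2 t) (pcomp y b)"
    by (metis pdom_pcomp)
  have d: "pdom x = pdom q1" using 1(5) by (metis pdom_pcomp)
  \<comment> \<open>The right-hand adjustment puts \<open>q2\<close> in front of both coordinates,
    so it also lengthens the \<open>q1\<close> and \<open>x\<close> found on the left.\<close>
  show thesis
    by (rule that[of "pcomp q2 q1" "pcomp q2 x" y]) (use 1 2 d pv in auto)
qed

lemma conj_at_imp_conjugate:
  assumes H: "zero_free H" and K: "zero_free K" and c: "conj_at a b H K"
  shows "sg_conjugate gis H K"
proof -
  \<comment> \<open>Stated for arbitrary sets and paths, since the reverse inclusion is the same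
    claim with the roles exchanged.\<close>
  have half: "gis_mult G (gis_mult G (Elt b a) h) (Elt a b) \<in> K"
    if "zero_free H" "conj_at a b H K" "h \<in> H" for a b h H K
  proof -
    from that(1,3) obtain v w where h: "h = Elt v w" by (rule zero_free_cases)
    have a: "Elt a a \<in> H" "pdom b = pdom a" using that(2) by (auto simp: conj_at_def)
    from common_tail[OF that(1) a(1) that(3)[unfolded h]] obtain x y
      where "x \<in> paths G" "y \<in> paths G" "pran G x = pdom a" "pran G y = pdom a"
        "Elt (pcomp x a) (pcomp y a) \<in> H"
        "gis_mult G (gis_mult G (Elt b a) (Elt v w)) (Elt a b) = Elt (pcomp x b) (pcomp y b)"
      using a(2) by metis
    then show ?thesis using conj_atD[OF that(2), of x y] h by simp
  qed
  have "Elt a b \<in> gis_carrier G"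
    using c zero_free_Elt[OF H, of a a] zero_free_Elt[OF K, of b b] by (auto simp: conj_at_def)
  then show ?thesis
    using half[OF H c] half[OF K conj_at_sym[OF c]]
    unfolding sg_conjugate_def by (intro bexI[of _ "Elt a b"]) auto
qed

text \<open>The conjugating element is itself the pair \<open>(a,b)\<close>. It is non-zero, and
  \<open>K\<close> omits zero, because otherwise conjugating back would put zero into
  \<open>H\<close>.\<close>

lemma conjugate_imp_conj_at:
  assumes H: "zero_free H" and K: "closed_inverse_subsemigroup gis K" and c: "sg_conjugate gis H K"
  obtains a b where "zero_free K" "conj_at a b H K"
proof -
  from c obtain s where s: "s \<in> gis_carrier G"
    "\<And>h. h \<in> H \<Longrightarrow> gis_mult G (gis_mult G (gis_inv s) h) s \<in> K"
    "\<And>k. k \<in> K \<Longrightarrow> gis_mult G (gis_mult G s k) (gis_inv s) \<in> H"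
    by (auto simp: sg_conjugate_def)
  have ZH: "Zero \<notin> H" using H by (simp add: zero_free_def)
  obtain k where k: "k \<in> K"
    using K by (auto simp: closed_inverse_subsemigroup_def inverse_subsemigroup_def)
  have "s \<noteq> Zero" using s(3)[OF k] ZH by auto
  then obtain a b where ab: "s = Elt a b" "a \<in> paths G" "b \<in> paths G" "pdom a = pdom b"
    using s(1) by (auto elim: carrier_cases)
  have K: "zero_free K" using s(3)[of Zero] ZH K by (auto simp: zero_free_def)
  have diag: "Elt a a \<in> H"
    if ab: "a \<in> paths G" "b \<in> paths G" "pdom a = pdom b" and H: "zero_free H" and K: "zero_free K"
    and c: "\<And>k. k \<in> K \<Longrightarrow> gis_mult G (gis_mult G (Elt a b) k) (Elt b a) \<in> H"
    for a b H K
  proof -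
    obtain k where k: "k \<in> K" using zero_free_nonempty[OF K] by blast
    with K obtain v w where "k = Elt v w" "v \<in> paths G" "w \<in> paths G" "pdom v = pdom w"
      by (rule zero_free_cases)
    then have kk: "Elt v v \<in> K" "v \<in> paths G" using k zero_free_diag[OF K] by auto
    have "gis_mult G (gis_mult G (Elt a b) (Elt v v)) (Elt b a) \<noteq> Zero"
      using c[OF kk(1)] H by (metis zero_free_def)
    then have "gis_mult G (Elt a b) (Elt v v) \<noteq> Zero" by auto
    \<comment> \<open>If \<open>v\<close> is a suffix of \<open>b\<close>, conjugating
      \<open>(v,v)\<close> gives \<open>(a,a)\<close>; if \<open>v = pb\<close>, it gives
      \<open>(pa,pa)\<close>. Upward closure then removes \<open>p\<close>.\<close>
    then have "\<exists>p \<in> paths G. pran G p = pdom a \<and> Elt (pcomp p a) (pcomp p a) \<in> H"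
    proof (cases rule: gis_mult_cases)
      case (1 p)
      then have "gis_mult G (gis_mult G (Elt a b) (Elt v v)) (Elt b a) = gis_mult G (Elt a b) (Elt b a)"
        by (simp add: gis_mult_left)
      also have "\<dots> = Elt a a"
        using gis_mult_left[of "(pdom b, [])" b a a] that(1-3)
        by (simp add: empty_path)
      finally show ?thesis using c[OF kk(1)] ab
        by (intro bexI[of _ "(pdom a, [])"])
          (auto simp: empty_path)
    next
      case (2 p)
      then have "gis_mult G (gis_mult G (Elt a b) (Elt v v)) (Elt b a) = Elt (pcomp p a) (pcomp p a)"
        using ab by (simp add: gis_mult_right gis_mult_left)
      then show ?thesis using 2 c[OF kk(1)] ab by auto
    qed
    then show ?thesis using zero_free_up[OF H] ab by blast
  qed
  have a: "Elt a a \<in> H" and b: "Elt b b \<in> K"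
    using diag[OF ab(2-4) H K] diag[OF ab(3,2) ab(4)[symmetric] K H] s(2,3) ab(1) by simp_all
  have "Elt (pcomp x a) (pcomp y a) \<in> H \<longleftrightarrow> Elt (pcomp x b) (pcomp y b) \<in> K"
    if "x \<in> paths G" "y \<in> paths G" "pran G x = pdom a" "pran G y = pdom a" for x y
  proof
    assume h: "Elt (pcomp x a) (pcomp y a) \<in> H"
    then have "pdom x = pdom y" using zero_free_Elt(3)[OF H h] by simp
    then show "Elt (pcomp x b) (pcomp y b) \<in> K"
      using s(2)[OF h] conj_mult[OF ab(2-4) that] ab(1) by simp
  next
    assume k: "Elt (pcomp x b) (pcomp y b) \<in> K"
    then have "pdom x = pdom y" using zero_free_Elt(3)[OF K k] by simp
    then show "Elt (pcomp x a) (pcomp y a) \<in> H"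
      using s(3)[OF k] conj_mult[OF ab(3,2) ab(4)[symmetric] that(1,2)] that ab by simp
  qed
  then have "conj_at a b H K" using a b ab by (auto simp: conj_at_def)
  then show thesis using K that by blast
qed

text \<open>The form in which conjugacy is applied: a member of \<open>H\<close> is lowered by a
  common prefix until both coordinates end in \<open>a\<close>, and is then carried to
  \<open>K\<close>.\<close>

lemma conj_at_tail:
  assumes "zero_free H" "conj_at a b H K" "Elt v w \<in> H"
  obtains q x y where "q \<in> paths G" "x \<in> paths G" "y \<in> paths G" "pran G q = pdom v"
    "pran G x = pdom a" "pran G y = pdom a" "pcomp q v = pcomp x a" "pcomp q w = pcomp y a"
    "Elt (pcomp x a) (pcomp y a) \<in> H" "Elt (pcomp x b) (pcomp y b) \<in> K"
proof -
  have a: "Elt a a \<in> H" using assms(2) by (simp add: conj_at_def)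
  from common_tail[OF assms(1) a assms(3)] obtain q x y where *: "q \<in> paths G" "x \<in> paths G"
    "y \<in> paths G" "pran G q = pdom v" "pran G x = pdom a" "pran G y = pdom a"
    "pcomp q v = pcomp x a" "pcomp q w = pcomp y a" "Elt (pcomp x a) (pcomp y a) \<in> H"
    by metis
  then show thesis using that conj_atD[OF assms(2) *(2,3,5,6)] by blast
qed

section \<open>Chain type\<close>

text \<open>Two members \<open>(v,v)\<close> and \<open>(w,w)\<close> have a non-zero product, so
  one path is a suffix of the other and the idempotents are comparable.\<close>

lemma idempotent_chain_iff:
  assumes H: "zero_free H"
  shows "idempotent_chain gis H \<longleftrightarrow> (\<forall>v w. Elt v w \<in> H \<longrightarrow> v = w)"
proof
  assume "idempotent_chain gis H"
  then show "\<forall>v w. Elt v w \<in> H \<longrightarrow> v = w"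
    using Elt_idempotents_iff by (auto simp: idempotent_chain_def)
next
  assume diag: "\<forall>v w. Elt v w \<in> H \<longrightarrow> v = w"
  have el: "\<exists>v. h = Elt v v \<and> v \<in> paths G" if "h \<in> H" for h
    using zero_free_cases[OF H that] diag that by metis
  have "nat_le gis h k \<or> nat_le gis k h" if "h \<in> H" "k \<in> H" for h k
  proof -
    from el that obtain v w where vw: "h = Elt v v" "k = Elt w w" "v \<in> paths G" "w \<in> paths G"
      by metis
    from H that[unfolded vw] show ?thesis
      by (cases rule: zero_free_mult_cases) (auto simp: vw nat_le_Elt_iff)
  qed
  moreover have "H \<subseteq> idempotents gis" using el Elt_idempotents_iff by blast
  ultimately show "idempotent_chain gis H" by (auto simp: idempotent_chain_def)
qed

lemma idempotent_chain_conj: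
  assumes H: "zero_free H" and K: "zero_free K" and c: "conj_at a b H K"
    and chain: "idempotent_chain gis H"
  shows "idempotent_chain gis K"
  unfolding idempotent_chain_iff[OF K]
proof (intro allI impI)
  fix v w assume vw: "Elt v w \<in> K"
  from conj_at_tail[OF K conj_at_sym[OF c] vw] obtain q x y
    where "pcomp q v = pcomp x b" "pcomp q w = pcomp y b" "Elt (pcomp x a) (pcomp y a) \<in> H"
    by metis
  \<comment> \<open>The transported element is diagonal in \<open>H\<close>, so
    \<open>x = y\<close>; hence \<open>qv = qw\<close>, and cancelling \<open>q\<close> gives
    \<open>v = w\<close>.\<close>
  then have "pcomp x a = pcomp y a" "pcomp q v = pcomp x b" "pcomp q w = pcomp y b"
    using chain unfolding idempotent_chain_iff[OF H] by blast+
  then have "pcomp q v = pcomp q w" by simp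
  then show "v = w" using zero_free_Elt[OF K vw] pcomp_left_cancel by blast
qed

text \<open>Paths in a chain are comparable suffixes, so those of equal length coincide. Length is
  therefore injective on \<open>H\<close>, and finiteness becomes boundedness of a set of
  naturals.\<close>

lemma finite_chain_iff_bounded:
  assumes H: "zero_free H" and chain: "idempotent_chain gis H"
  shows "finite H \<longleftrightarrow> (\<exists>N. \<forall>v w. Elt v w \<in> H \<longrightarrow> plength v \<le> N)"
proof -
  define len :: "('a, 'b) gis \<Rightarrow> nat" where "len h = (case h of Elt v w \<Rightarrow> plength v | Zero \<Rightarrow> 0)" for h
  have el: "\<exists>v. h = Elt v v" if "h \<in> H" for h
    using zero_free_cases[OF H that] chain that by (metis H idempotent_chain_iff)
  have inj: "inj_on len H"
  proof (rule inj_onI)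
    fix h k assume hk: "h \<in> H" "k \<in> H" "len h = len k"
    then obtain v w where "h = Elt v v" "k = Elt w w" using el by blast
    with hk(3) have vw: "h = Elt v v" "k = Elt w w" "plength v = plength w"
      by (simp_all add: len_def)
    have triv: "pcomp p x = x" if "pran G p = pdom x" "plength (pcomp p x) = plength x" for p x
      using that by (simp add: pcomp_empty_left plength_0_pran)
    from H hk(1,2)[unfolded vw] have "v = w"
      by (cases rule: zero_free_mult_cases) (use vw(3) triv in metis)+
    then show "h = k" using vw by simp
  qed
  have "finite H \<longleftrightarrow> finite (len ` H)" using inj by (simp add: finite_image_iff)
  also have "\<dots> \<longleftrightarrow> (\<exists>N. \<forall>v w. Elt v w \<in> H \<longrightarrow> plength v \<le> N)"
  proof -
    have "(\<forall>n \<in> len ` H. n \<le> N) \<longleftrightarrow> (\<forall>v w. Elt v w \<in> H \<longrightarrow> plength v \<le> N)" for N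
    proof -
      have "(\<forall>h \<in> H. len h \<le> N) \<longleftrightarrow> (\<forall>v w. Elt v w \<in> H \<longrightarrow> len (Elt v w) \<le> N)"
        using el by metis
      then show ?thesis by (simp add: len_def)
    qed
    then show ?thesis unfolding finite_nat_set_iff_bounded_le by simp
  qed
  finally show ?thesis .
qed

lemma finite_chain_conj:
  assumes H: "zero_free H" and K: "zero_free K" and c: "conj_at a b H K"
    and chain: "idempotent_chain gis H" and fin: "finite H"
  shows "finite K"
proof -
  obtain N where N: "\<And>v w. Elt v w \<in> H \<Longrightarrow> plength v \<le> N"
    using fin finite_chain_iff_bounded[OF H chain] by blast
  have "plength v \<le> N + plength b" if vw: "Elt v w \<in> K" for v w
  proof -
    from conj_at_tail[OF K conj_at_sym[OF c] vw] obtain q x y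
      where "pcomp q v = pcomp x b" "Elt (pcomp x a) (pcomp y a) \<in> H" by metis
    then have "plength q + plength v = plength x + plength b" "plength x + plength a \<le> N"
      using N by (metis plength_pcomp)+
    then show ?thesis by simp
  qed
  then show ?thesis
    using finite_chain_iff_bounded[OF K idempotent_chain_conj[OF H K c chain]] by blast
qed

lemma finite_chain_type_conj:
  assumes "finite_chain_type gis L" "closed_inverse_subsemigroup gis K" "sg_conjugate gis L K"
  shows "finite_chain_type gis K"
proof -
  have L: "zero_free L" using assms(1) by (simp add: finite_chain_type_def proper_iff_zero_free)
  obtain a b where "zero_free K" "conj_at a b L K"
    using conjugate_imp_conj_at[OF L assms(2,3)] .
  then show ?thesis
    using assms(1) L idempotent_chain_conj finite_chain_conj
    by (auto simp: finite_chain_type_def proper_iff_zero_free)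
qed

lemma infinite_chain_type_conj:
  assumes "infinite_chain_type gis L" "closed_inverse_subsemigroup gis K" "sg_conjugate gis L K"
  shows "infinite_chain_type gis K"
proof -
  have L: "zero_free L" "idempotent_chain gis L" "infinite L"
    using assms(1) by (simp_all add: infinite_chain_type_def proper_iff_zero_free)
  obtain a b where K: "zero_free K" and c: "conj_at a b L K"
    using conjugate_imp_conj_at[OF L(1) assms(2,3)] .
  have "idempotent_chain gis K" using idempotent_chain_conj[OF L(1) K c L(2)] .
  moreover from this have "infinite K"
    using finite_chain_conj[OF K L(1) conj_at_sym[OF c]] L(3) by blast
  ultimately show ?thesis
    using K by (simp add: infinite_chain_type_def proper_iff_zero_free)
qed

lemma infinite_chain_conjugate_iff:
  assumes "infinite_chain_type gis L" "infinite_chain_type gis K"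
  shows "sg_conjugate gis L K \<longleftrightarrow>
    (\<exists>s t. Elt s s \<in> L \<and> Elt t t \<in> K \<and>
      (\<forall>p \<in> paths G.
        (pran G p = pdom s \<and> Elt (pcomp p s) (pcomp p s) \<in> L) \<longleftrightarrow>
        (pran G p = pdom t \<and> Elt (pcomp p t) (pcomp p t) \<in> K)))"
  (is "_ \<longleftrightarrow> ?r")
proof -
  have L: "zero_free L" "idempotent_chain gis L" and K: "zero_free K" "idempotent_chain gis K"
    using assms by (simp_all add: infinite_chain_type_def proper_iff_zero_free)
  note diag = L(2)[unfolded idempotent_chain_iff[OF L(1)]] K(2)[unfolded idempotent_chain_iff[OF K(1)]]
  show ?thesis
  proof
    assume c: "sg_conjugate gis L K"
    have "closed_inverse_subsemigroup gis K" using K(1) by (simp add: zero_free_def)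
    from conjugate_imp_conj_at[OF L(1) this c] obtain a b where "conj_at a b L K" by metis
    then show ?r by (intro exI[of _ a] exI[of _ b]) (auto simp: conj_at_def)
  next
    assume ?r
    then obtain s t where st: "Elt s s \<in> L" "Elt t t \<in> K"
      "\<And>p. p \<in> paths G \<Longrightarrow> (pran G p = pdom s \<and> Elt (pcomp p s) (pcomp p s) \<in> L) \<longleftrightarrow>
        (pran G p = pdom t \<and> Elt (pcomp p t) (pcomp p t) \<in> K)" by blast
    \<comment> \<open>Testing the condition on the empty path at \<open>pdom s\<close> forces the
      two initial vertices to agree.\<close>
    have "(pdom s, []) \<in> paths G" using zero_free_Elt[OF L(1) st(1)] empty_path by blast
    from st(3)[OF this] st(1) have d: "pdom s = pdom t" by auto
    have "Elt (pcomp x s) (pcomp y s) \<in> L \<longleftrightarrow> Elt (pcomp x t) (pcomp y t) \<in> K"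
      if "x \<in> paths G" "y \<in> paths G" "pran G x = pdom s" "pran G y = pdom s" for x y
    proof (cases "x = y")
      case True
      then show ?thesis using st(3)[of x] that d by simp
    next
      \<comment> \<open>For \<open>x \<noteq> y\<close> both pairs are off the diagonal, so neither
        lies in its chain of idempotents.\<close>
      case False
      then have "pcomp x s \<noteq> pcomp y s" "pcomp x t \<noteq> pcomp y t" by simp_all
      then show ?thesis using diag by blast
    qed
    then have "conj_at s t L K" using st(1,2) d by (auto simp: conj_at_def)
    then show "sg_conjugate gis L K" using conj_at_imp_conjugate L(1) K(1) by blast
  qed
qed

text \<open>The product condition is phrased through a factorization, which at once shows the
  product to be non-zero and names its value.\<close>

lemma zero_freeI:
  assumes ne: "H \<noteq> {}"
    and elt: "\<And>h. h \<in> H \<Longrightarrow> \<exists>v w. h = Elt v w \<and> v \<in> paths G \<and> w \<in> paths G \<and> pdom v = pdom w"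
    and inv: "\<And>v w. Elt v w \<in> H \<Longrightarrow> Elt w v \<in> H"
    and up: "\<And>q v w. q \<in> paths G \<Longrightarrow> v \<in> paths G \<Longrightarrow> w \<in> paths G \<Longrightarrow> pran G q = pdom v \<Longrightarrow>
      pdom v = pdom w \<Longrightarrow> Elt (pcomp q v) (pcomp q w) \<in> H \<Longrightarrow> Elt v w \<in> H"
    and mult: "\<And>t u v w. Elt t u \<in> H \<Longrightarrow> Elt v w \<in> H \<Longrightarrow> \<exists>p \<in> paths G.
      pran G p = pdom v \<and> u = pcomp p v \<and> Elt t (pcomp p w) \<in> H \<or>
      pran G p = pdom u \<and> v = pcomp p u \<and> Elt (pcomp p t) w \<in> H"
  shows "zero_free H"
proof -
  have Z: "Zero \<notin> H" using elt by blast
  have sub: "H \<subseteq> gis_carrier G" using elt by force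
  have "gis_mult G h k \<in> H" if hk: "h \<in> H" "k \<in> H" for h k
  proof -
    obtain t u v w where e: "h = Elt t u" "t \<in> paths G" "u \<in> paths G" "pdom t = pdom u"
      "k = Elt v w" "v \<in> paths G" "w \<in> paths G" "pdom v = pdom w"
      using elt hk by metis
    from mult[OF hk[unfolded e]] e show ?thesis
      by (auto simp: gis_mult_left gis_mult_right)
  qed
  moreover have "gis_inv h \<in> H" if "h \<in> H" for h
    using elt[OF that] inv that by auto
  moreover have "s \<in> H" if hs: "h \<in> H" "s \<in> gis_carrier G" "nat_le gis h s" for h s
  proof -
    obtain v w where h: "h = Elt v w" using elt[OF hs(1)] by blast
    show ?thesis
    proof (cases s)
      case Zero
      then show ?thesis using hs(3) h by (auto simp: nat_le_def)
    next
      case (Elt x y)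
      from hs(3)[unfolded h Elt nat_le_Elt_iff] obtain q where "x \<in> paths G" "y \<in> paths G"
        "pdom x = pdom y" "q \<in> paths G" "pran G q = pdom x" "v = pcomp q x" "w = pcomp q y"
        by blast
      then show ?thesis using up hs(1) h Elt by blast
    qed
  qed
  ultimately show ?thesis
    using ne Z sub unfolding zero_free_def closed_inverse_subsemigroup_def
      inverse_subsemigroup_def sg_closed_def by (metis gis_simps)
qed

section \<open>The closed sets generated by a single idempotent\<close>

lemma up_path_eq:
  assumes u: "u \<in> paths G"
  shows "up_path G u = {Elt w w | w. psuffix G w u}"
proof (intro subset_antisym subsetI)
  fix s assume "s \<in> up_path G u"
  then have s: "s \<in> gis_carrier G" "nat_le gis (Elt u u) s" by (auto simp: up_set_def)
  from s(1) show "s \<in> {Elt w w | w. psuffix G w u}"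
  proof (cases rule: carrier_cases)
    case 1
    then show ?thesis using s by (auto simp: nat_le_def)
  next
    case (2 v w)
    from s(2)[unfolded 2(1) nat_le_Elt_iff] obtain q where
      q: "q \<in> paths G" "pran G q = pdom v" "u = pcomp q v" "u = pcomp q w" by blast
    then have "v = w" using 2(4) by (metis pcomp_left_cancel)
    then show ?thesis using 2 q unfolding psuffix_def factors_def by blast
  qed
next
  fix s assume "s \<in> {Elt w w | w. psuffix G w u}"
  then show "s \<in> up_path G u"
    using u by (auto simp: up_set_def psuffix_def factors_def nat_le_Elt_iff)
qed

lemma Elt_up_path_iff:
  "u \<in> paths G \<Longrightarrow> Elt v w \<in> up_path G u \<longleftrightarrow> v = w \<and> psuffix G v u"
  by (auto simp: up_path_eq)

lemma psuffix_refl: "u \<in> paths G \<Longrightarrow> psuffix G u u"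
  unfolding psuffix_def factors_def by (intro exI[of _ "(pdom u, [])"]) (auto simp: empty_path)

lemma psuffix_antisym: "psuffix G u v \<Longrightarrow> psuffix G v u \<Longrightarrow> u = v"
proof -
  assume "psuffix G u v" "psuffix G v u"
  then obtain p q where pq: "v = pcomp p u" "u = pcomp q v" "pran G p = pdom u"
    unfolding psuffix_def factors_def by blast
  then have "plength v = plength p + plength u" "plength u = plength q + plength v"
    by (metis plength_pcomp)+
  then have "plength p = 0" by simp
  then show "u = v" using pq plength_0_pran by (metis pcomp_empty_left)
qed

text \<open>Equal sets have generators that are suffixes of each other, hence equal, so the definite
  description in \<open>chain_root\<close> returns \<open>u\<close>.\<close>

lemma chain_root_up_path:
  assumes "u \<in> paths G"
  shows "chain_root G (up_path G u) = pdom u"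
proof -
  have "(THE u'. u' \<in> paths G \<and> up_path G u = up_path G u') = u"
  proof (rule the_equality)
    fix u' assume u': "u' \<in> paths G \<and> up_path G u = up_path G u'"
    then have "Elt u u \<in> up_path G u'" "Elt u' u' \<in> up_path G u"
      using assms psuffix_refl Elt_up_path_iff by blast+
    then show "u' = u" using u' assms psuffix_antisym Elt_up_path_iff by blast
  qed (use assms in simp)
  then show ?thesis by (simp add: chain_root_def)
qed

lemma zero_free_up_path:
  assumes u: "u \<in> paths G"
  shows "zero_free (up_path G u)"
proof (rule zero_freeI)
  show "up_path G u \<noteq> {}" using psuffix_refl[OF u] Elt_up_path_iff[OF u] by blast
next
  fix h assume "h \<in> up_path G u"
  then show "\<exists>v w. h = Elt v w \<and> v \<in> paths G \<and> w \<in> paths G \<and> pdom v = pdom w"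
    using u by (auto simp: up_path_eq psuffix_def factors_def)
next
  fix v w assume "Elt v w \<in> up_path G u"
  then show "Elt w v \<in> up_path G u" using u by (auto simp: up_path_eq)
next
  fix q v w
  assume *: "q \<in> paths G" "v \<in> paths G" "w \<in> paths G" "pran G q = pdom v" "pdom v = pdom w"
    "Elt (pcomp q v) (pcomp q w) \<in> up_path G u"
  then have "pcomp q v = pcomp q w" "psuffix G (pcomp q v) u" using Elt_up_path_iff[OF u] by auto
  moreover from this obtain e where "e \<in> paths G" "pran G e = pdom q" "u = pcomp e (pcomp q v)"
    unfolding psuffix_def factors_def by (metis pdom_pcomp)
  then have "factors G u (pcomp e q) v" using * by (simp add: factors_def)
  ultimately show "Elt v w \<in> up_path G u"
    using * Elt_up_path_iff[OF u] pcomp_left_cancel unfolding psuffix_def by blast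
next
  fix t x v w assume *: "Elt t x \<in> up_path G u" "Elt v w \<in> up_path G u"
  then obtain e f where e: "t = x" "v = w" "e \<in> paths G" "x \<in> paths G" "pran G e = pdom x"
    "u = pcomp e x" "f \<in> paths G" "v \<in> paths G" "pran G f = pdom v" "u = pcomp f v"
    unfolding Elt_up_path_iff[OF u] psuffix_def factors_def by blast
  \<comment> \<open>Two suffixes of the same path \<open>u\<close> are comparable by Levi's lemma,
    which supplies the required factorization.\<close>
  from e(6,10) have "pcomp e x = pcomp f v" by simp
  from e(3-5,7-9) this
  show "\<exists>p \<in> paths G. pran G p = pdom v \<and> x = pcomp p v \<and> Elt t (pcomp p w) \<in> up_path G u \<or>
      pran G p = pdom x \<and> v = pcomp p x \<and> Elt (pcomp p t) w \<in> up_path G u"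
    by (cases rule: levi_cases) (use * e in auto)
qed

lemma up_path_conjugate_iff:
  assumes u: "u \<in> paths G" and v: "v \<in> paths G"
  shows "sg_conjugate gis (up_path G u) (up_path G v) \<longleftrightarrow> pdom u = pdom v"
proof
  assume "sg_conjugate gis (up_path G u) (up_path G v)"
  then obtain a b where c: "conj_at a b (up_path G u) (up_path G v)"
    using conjugate_imp_conj_at[OF zero_free_up_path[OF u]] zero_free_up_path[OF v]
    by (metis zero_free_def)
  \<comment> \<open>The generator \<open>(u,u) = (pa,pa)\<close> is carried to
    \<open>(pb,pb)\<close>, so \<open>pb\<close> is a suffix of \<open>v\<close>.\<close>
  have root: "\<exists>p r. p \<in> paths G \<and> r \<in> paths G \<and> pran G p = pdom a \<and> pran G r = pdom p \<and>
      u = pcomp p a \<and> v = pcomp r (pcomp p b)"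
    if u: "u \<in> paths G" and v: "v \<in> paths G" and c: "conj_at a b (up_path G u) (up_path G v)"
    for a b u v
  proof -
    have "psuffix G a u" using c Elt_up_path_iff[OF u] by (simp add: conj_at_def)
    then obtain p where p: "p \<in> paths G" "pran G p = pdom a" "u = pcomp p a"
      unfolding psuffix_def factors_def by blast
    then have "Elt (pcomp p a) (pcomp p a) \<in> up_path G u"
      using psuffix_refl[OF u] Elt_up_path_iff[OF u] by simp
    then have "psuffix G (pcomp p b) v"
      using conj_atD[OF c, of p p] p Elt_up_path_iff[OF v] by simp
    then show ?thesis using p unfolding psuffix_def factors_def by (metis pdom_pcomp)
  qed
  obtain p r where pr: "pran G r = pdom p" "u = pcomp p a" "v = pcomp r (pcomp p b)"
    using root[OF u v c] by blast
  obtain p' r' where pr': "v = pcomp p' b" "u = pcomp r' (pcomp p' a)"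
    using root[OF v u conj_at_sym[OF c]] by blast
  \<comment> \<open>Using the decomposition in both directions gives
    \<open>|u| = |r'| + |r| + |u|\<close>. Thus \<open>u = pa\<close> and \<open>v = pb\<close> both
    start where \<open>p\<close> does.\<close>
  have "plength r = 0"
    using arg_cong[OF pr(2), of plength] arg_cong[OF pr(3), of plength]
      arg_cong[OF pr'(1), of plength] arg_cong[OF pr'(2), of plength] by simp
  then show "pdom u = pdom v" using plength_0_pran pr by simp
next
  assume d: "pdom u = pdom v"
  \<comment> \<open>No suffix of \<open>u\<close> is longer than \<open>u\<close>, so membership
    depends on \<open>x\<close> and \<open>y\<close> alone and transfers from \<open>u\<close> to
    \<open>v\<close>.\<close>
  have "Elt (pcomp x u) (pcomp y u) \<in> up_path G u \<longleftrightarrow> x = y \<and> plength x = 0"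
    if "u \<in> paths G" "x \<in> paths G" "pran G x = pdom u" for x y u
  proof
    assume "Elt (pcomp x u) (pcomp y u) \<in> up_path G u"
    then have "x = y" "psuffix G (pcomp x u) u" using that by (auto simp: Elt_up_path_iff)
    moreover from this(2) obtain e where "u = pcomp e (pcomp x u)"
      unfolding psuffix_def factors_def by blast
    then have "plength u = plength e + (plength x + plength u)" by (metis plength_pcomp)
    ultimately show "x = y \<and> plength x = 0" by simp
  next
    assume xy: "x = y \<and> plength x = 0"
    then have "pcomp x u = u" using that(3) pcomp_empty_left plength_0_pran by metis
    with xy show "Elt (pcomp x u) (pcomp y u) \<in> up_path G u"
      using that psuffix_refl[of u] by (simp add: Elt_up_path_iff)
  qed
  then have "conj_at u v (up_path G u) (up_path G v)"
    using u v d psuffix_refl[of u] psuffix_refl[of v] by (auto simp: conj_at_def Elt_up_path_iff)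
  then show "sg_conjugate gis (up_path G u) (up_path G v)"
    using conj_at_imp_conjugate zero_free_up_path u v by blast
qed

section \<open>Cycle type\<close>

text \<open>The upward closure of the bicyclic monoid of all \<open>(p\<^sup>r d, p\<^sup>s d)\<close>; here \<open>p\<close> and \<open>d\<close> may
  share a prefix.\<close>

definition cycle_closure ::
    "('a, 'b) dpath \<Rightarrow> ('a, 'b) dpath \<Rightarrow> ('a, 'b) gis set" where
  "cycle_closure p d = {Elt x y | x y. x \<in> paths G \<and> y \<in> paths G \<and>
     (\<exists>e \<in> paths G. \<exists>r s. pran G e = pdom x \<and> pran G e = pdom y \<and>
       pcomp e x = pcomp (ppow p r) d \<and> pcomp e y = pcomp (ppow p s) d)}"

lemma Elt_cycle_closure_iff:
  "Elt x y \<in> cycle_closure p d \<longleftrightarrow> x \<in> paths G \<and> y \<in> paths G \<and>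
     (\<exists>e \<in> paths G. \<exists>r s. pran G e = pdom x \<and> pran G e = pdom y \<and>
       pcomp e x = pcomp (ppow p r) d \<and> pcomp e y = pcomp (ppow p s) d)"
  by (simp add: cycle_closure_def)

lemma Elt_cycle_closureI:
  assumes "x \<in> paths G" "y \<in> paths G" "e \<in> paths G" "pran G e = pdom x" "pran G e = pdom y"
    "pcomp e x = pcomp (ppow p r) d" "pcomp e y = pcomp (ppow p s) d"
  shows "Elt x y \<in> cycle_closure p d"
  using assms by (auto simp: Elt_cycle_closure_iff)

lemma Elt_cycle_closureE:
  assumes "Elt x y \<in> cycle_closure p d"
  obtains e r s where "x \<in> paths G" "y \<in> paths G" "e \<in> paths G" "pran G e = pdom x"
    "pran G e = pdom y" "pcomp e x = pcomp (ppow p r) d" "pcomp e y = pcomp (ppow p s) d"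
    "pdom e = pdom p"
proof -
  from assms obtain e r s where *: "x \<in> paths G" "y \<in> paths G" "e \<in> paths G" "pran G e = pdom x"
    "pran G e = pdom y" "pcomp e x = pcomp (ppow p r) d" "pcomp e y = pcomp (ppow p s) d"
    by (auto simp: Elt_cycle_closure_iff)
  moreover have "pdom e = pdom p" using arg_cong[OF *(6), of pdom] by simp
  ultimately show thesis using that by blast
qed

lemma cycle_closure_base:
  assumes "circuit G p" "d \<in> paths G" "pdom d = pdom p"
  shows "Elt (pcomp (ppow p r) d) (pcomp (ppow p s) d) \<in> cycle_closure p d"
  by (rule Elt_cycle_closureI[where e = "(pdom p, [])" and r = r and s = s])
    (use assms circuit_paths empty_path in auto)

lemma cycle_closure_eqI:
  assumes "\<And>v w. Elt v w \<in> cycle_closure p d \<longleftrightarrow> Elt v w \<in> K" "zero_free K"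
  shows "cycle_closure p d = K"
proof -
  have "\<exists>v w. h = Elt v w" if "h \<in> cycle_closure p d \<or> h \<in> K" for h
    using that
  proof
    assume "h \<in> K"
    with assms(2) show ?thesis by (rule zero_free_cases) blast
  qed (auto simp: cycle_closure_def)
  then show ?thesis using assms(1) by blast
qed

lemma zero_free_cycle_closure:
  assumes p: "circuit G p" and d: "d \<in> paths G" "pdom d = pdom p"
  shows "zero_free (cycle_closure p d)"
proof (rule zero_freeI)
  show "cycle_closure p d \<noteq> {}" using cycle_closure_base[OF assms] by blast
next
  fix h assume "h \<in> cycle_closure p d"
  then show "\<exists>v w. h = Elt v w \<and> v \<in> paths G \<and> w \<in> paths G \<and> pdom v = pdom w"
    unfolding cycle_closure_def by force
next
  fix v w assume "Elt v w \<in> cycle_closure p d"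
  then show "Elt w v \<in> cycle_closure p d" by (meson Elt_cycle_closureE Elt_cycle_closureI)
next
  fix q v w
  assume *: "q \<in> paths G" "v \<in> paths G" "w \<in> paths G" "pran G q = pdom v" "pdom v = pdom w"
    "Elt (pcomp q v) (pcomp q w) \<in> cycle_closure p d"
  from *(6) obtain e r s where e: "e \<in> paths G" "pran G e = pdom q"
     "pcomp e (pcomp q v) = pcomp (ppow p r) d" "pcomp e (pcomp q w) = pcomp (ppow p s) d"
    by (rule Elt_cycle_closureE) auto
  show "Elt v w \<in> cycle_closure p d"
    by (rule Elt_cycle_closureI[where e = "pcomp e q" and r = r and s = s]) (use * e in auto)
next
  fix t u v w assume *: "Elt t u \<in> cycle_closure p d" "Elt v w \<in> cycle_closure p d"
  from *(1) obtain e r s where e: "t \<in> paths G" "u \<in> paths G" "e \<in> paths G" "pran G e = pdom t"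
    "pran G e = pdom u" "pcomp e t = pcomp (ppow p r) d" "pcomp e u = pcomp (ppow p s) d"
    "pdom e = pdom p" by (rule Elt_cycle_closureE)
  from *(2) obtain e' r' s' where e': "v \<in> paths G" "w \<in> paths G" "e' \<in> paths G" "pran G e' = pdom v"
    "pran G e' = pdom w" "pcomp e' v = pcomp (ppow p r') d" "pcomp e' w = pcomp (ppow p s') d"
    "pdom e' = pdom p" by (rule Elt_cycle_closureE)
  \<comment> \<open>These prefixes extend \<open>u\<close> and \<open>v\<close> to the same path
    \<open>p^(r'+s) d\<close>, which makes Levi's lemma applicable.\<close>
  let ?f = "pcomp (ppow p r') e" and ?f' = "pcomp (ppow p s) e'"
  have f: "?f \<in> paths G" "pran G ?f = pdom u" "?f' \<in> paths G" "pran G ?f' = pdom v"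
    using e e' p by simp_all
  have "pcomp ?f u = pcomp ?f' v"
    using e(7) e'(6) by (simp add: ppow_add_pcomp add.commute)
  from f(1) e(2) f(2,3) e'(1) f(4) this
  show "\<exists>x \<in> paths G. pran G x = pdom v \<and> u = pcomp x v \<and> Elt t (pcomp x w) \<in> cycle_closure p d \<or>
      pran G x = pdom u \<and> v = pcomp x u \<and> Elt (pcomp x t) w \<in> cycle_closure p d"
  proof (cases rule: levi_cases)
    case (1 h)
    have "pcomp ?f (pcomp h w) = pcomp ?f' w" using 1(4) by (metis pcomp_assoc)
    also have "\<dots> = pcomp (ppow p (s + s')) d" using e'(7) by (simp add: ppow_add_pcomp)
    finally have "pcomp ?f (pcomp h w) = pcomp (ppow p (s + s')) d" .
    then have "Elt t (pcomp h w) \<in> cycle_closure p d"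
      using 1 e e' p f
      by (intro Elt_cycle_closureI[where e = ?f and r = "r' + r" and s = "s + s'"])
        (auto simp: ppow_add_pcomp)
    then show ?thesis using 1 by blast
  next
    case (2 h)
    have "pcomp ?f' (pcomp h t) = pcomp ?f t" using 2(4) by (metis pcomp_assoc)
    also have "\<dots> = pcomp (ppow p (r' + r)) d" using e(6) by (simp add: ppow_add_pcomp)
    finally have "pcomp ?f' (pcomp h t) = pcomp (ppow p (r' + r)) d" .
    then have "Elt (pcomp h t) w \<in> cycle_closure p d"
      using 2 e e' p f
      by (intro Elt_cycle_closureI[where e = ?f' and r = "r' + r" and s = "s + s'"])
        (auto simp: ppow_add_pcomp)
    then show ?thesis using 2 by blast
  qed
qed

lemma cycle_closure_rotate:
  assumes c: "circuit G (pcomp u v)" and uv: "u \<in> paths G" "v \<in> paths G" "pran G u = pdom v"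
    and d: "d \<in> paths G" "pran G u = pdom d"
  shows "cycle_closure (pcomp u v) (pcomp u d) = cycle_closure (pcomp v u) d"
proof (rule cycle_closure_eqI)
  have c': "circuit G (pcomp v u)" using circuit_rotate[OF c uv] .
  show "zero_free (cycle_closure (pcomp v u) d)"
    using zero_free_cycle_closure[OF c' d(1)] d uv by simp
  have vu: "pran G v = pdom u" using circuit_pran[OF c] uv by simp
  fix x y
  show "Elt x y \<in> cycle_closure (pcomp u v) (pcomp u d) \<longleftrightarrow> Elt x y \<in> cycle_closure (pcomp v u) d"
  proof
    assume "Elt x y \<in> cycle_closure (pcomp u v) (pcomp u d)"
    then obtain e r s where e: "x \<in> paths G" "y \<in> paths G" "e \<in> paths G" "pran G e = pdom x"
      "pran G e = pdom y" "pcomp e x = pcomp (ppow (pcomp u v) r) (pcomp u d)"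
      "pcomp e y = pcomp (ppow (pcomp u v) s) (pcomp u d)" "pdom e = pdom (pcomp u v)"
      by (rule Elt_cycle_closureE)
    show "Elt x y \<in> cycle_closure (pcomp v u) d"
      \<comment> \<open>Prefixing \<open>v\<close> turns \<open>(uv)^r ud\<close> into
        \<open>(vu)^(r+1) d\<close>, hence the successors. In the converse direction prefixing
        \<open>u\<close> keeps the exponents.\<close>
      by (rule Elt_cycle_closureI[where e = "pcomp v e" and r = "Suc r" and s = "Suc s"])
        (use e uv vu in \<open>auto simp: ppow_rotate_pcomp\<close>)
  next
    assume "Elt x y \<in> cycle_closure (pcomp v u) d"
    then obtain e r s where e: "x \<in> paths G" "y \<in> paths G" "e \<in> paths G" "pran G e = pdom x"
      "pran G e = pdom y" "pcomp e x = pcomp (ppow (pcomp v u) r) d"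
      "pcomp e y = pcomp (ppow (pcomp v u) s) d" "pdom e = pdom (pcomp v u)"
      by (rule Elt_cycle_closureE)
    show "Elt x y \<in> cycle_closure (pcomp u v) (pcomp u d)"
      by (rule Elt_cycle_closureI[where e = "pcomp u e" and r = r and s = s])
        (use e uv vu in \<open>auto simp: ppow_rotate_pcomp\<close>)
  qed
qed

lemma cycle_closure_ppow:
  assumes p: "circuit G p" and d: "d \<in> paths G" "pdom d = pdom p"
  shows "cycle_closure p (pcomp (ppow p r) d) = cycle_closure p d"
proof (induction r)
  case 0
  then show ?case using d by simp
next
  case (Suc r)
  \<comment> \<open>A full turn: rotating by \<open>u = p\<close> with \<open>v\<close> empty
    removes one copy of \<open>p\<close> from the tail and leaves the circuit unchanged.\<close>
  let ?e = "(pdom p, [])"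
  have "pcomp p ?e = p" by (simp add: pcomp_empty_right)
  then show ?case
    using cycle_closure_rotate[of p ?e "pcomp (ppow p r) d"] p d Suc
      empty_path[OF circuit_paths[OF p]] circuit_paths[OF p] by simp
qed

text \<open>Rotating away a common prefix of positive length shortens \<open>d\<close>, so the
  process ends with a pair that satisfies \<open>cycle_data\<close>.\<close>

lemma cycle_closure_normalize:
  assumes "circuit G p" "d \<in> paths G" "pdom d = pdom p"
  shows "\<exists>q k. cycle_data G q k \<and> cycle_closure p d = cycle_closure q k"
  using assms
proof (induction "plength d" arbitrary: p d rule: less_induct)
  case less
  show ?case
  proof (cases "cycle_data G p d")
    case False
    with less.prems obtain w where w: "plength w > 0" "pprefix G w p" "pprefix G w d"
      unfolding cycle_data_def by blast
    then obtain v d' where *: "w \<in> paths G" "v \<in> paths G" "pran G w = pdom v" "p = pcomp w v"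
      "d' \<in> paths G" "pran G w = pdom d'" "d = pcomp w d'"
      unfolding pprefix_def factors_def by blast
    have c: "circuit G (pcomp v w)" using less.prems(1) * circuit_rotate by blast
    have "\<exists>q k. cycle_data G q k \<and> cycle_closure (pcomp v w) d' = cycle_closure q k"
      by (rule less.hyps) (use c * w(1) in auto)
    then show ?thesis using cycle_closure_rotate[of w v d'] * less.prems(1) by simp
  qed blast
qed

section \<open>Agreement of the closure with \<open>cycle_subsemigroup\<close>\<close>

lemma psuffixE:
  assumes "psuffix G v u"
  obtains q where "q \<in> paths G" "v \<in> paths G" "pran G q = pdom v" "u = pcomp q v"
  using assms unfolding psuffix_def factors_def by blast

lemma psuffixI: "q \<in> paths G \<Longrightarrow> v \<in> paths G \<Longrightarrow> pran G q = pdom v \<Longrightarrow> psuffix G v (pcomp q v)"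
  unfolding psuffix_def factors_def by blast

lemma cycle_subsemigroup_memI1:
  "psuffix G v p \<Longrightarrow>
    Elt (pcomp v (pcomp (ppow p r) d)) (pcomp v (pcomp (ppow p s) d)) \<in> cycle_subsemigroup G p d"
  unfolding cycle_subsemigroup_def by blast

lemma cycle_subsemigroup_memI2: "psuffix G q d \<Longrightarrow> Elt q q \<in> cycle_subsemigroup G p d"
  unfolding cycle_subsemigroup_def by blast

lemma cycle_subsemigroup_sym:
  "Elt x y \<in> cycle_subsemigroup G p d \<Longrightarrow> Elt y x \<in> cycle_subsemigroup G p d"
  unfolding cycle_subsemigroup_def by blast

text \<open>With \<open>s = 0\<close> both paths are the same suffix of \<open>d\<close>. With
  \<open>s > 0\<close>, either \<open>e\<close> is a common prefix of \<open>p\<close> and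
  \<open>d\<close>, hence empty, or \<open>p\<close> itself would be a prefix of \<open>d\<close>,
  which is excluded.\<close>

lemma cycle_subsemigroup_base_case:
  assumes cd: "cycle_data G p d" and e: "e \<in> paths G" "x \<in> paths G" "y \<in> paths G"
    "pran G e = pdom x" "pran G e = pdom y" "pcomp e x = d" "pcomp e y = pcomp (ppow p s) d"
  shows "Elt x y \<in> cycle_subsemigroup G p d"
proof (cases s)
  case 0
  have "d = pcomp e y" using e(7) 0 cd by (simp add: cycle_data_def)
  then have "x = y" using e by (metis pcomp_left_cancel)
  moreover have "psuffix G x d" using e psuffixI[of e x] by simp
  ultimately show ?thesis using cycle_subsemigroup_memI2 by blast
next
  case (Suc n)
  have p: "circuit G p" and d: "d \<in> paths G" "pdom d = pdom p"
    and np: "\<And>w. plength w > 0 \<Longrightarrow> pprefix G w p \<Longrightarrow> pprefix G w d \<Longrightarrow> False"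
    using cd unfolding cycle_data_def by blast+
  have pp: "p \<in> paths G" using p circuit_paths by blast
  have "pcomp (ppow p n) d \<in> paths G" "pran G p = pdom (pcomp (ppow p n) d)"
    "pcomp e y = pcomp p (pcomp (ppow p n) d)"
    using p d e Suc by simp_all
  from e(1,3,5) pp this have "plength e = 0"
  proof (cases rule: levi_cases)
    case (1 h)
    have "pprefix G e p" "pprefix G e d"
      using 1 e(1,2,4,6) unfolding pprefix_def factors_def by blast+
    then show ?thesis using np by blast
  next
    case (2 h)
    have "d = pcomp p (pcomp h x)" using 2(4) e(6) by simp
    then have "pprefix G p d" using 2 pp e(1,2,4)
      by (auto simp: pprefix_def factors_def intro!: exI[of _ "pcomp h x"])
    moreover have "pprefix G p p" using pp p empty_path[OF pp]
      by (auto simp: pprefix_def factors_def pcomp_empty_right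
          intro!: exI[of _ "(pdom p, [])"])
    ultimately show ?thesis using np circuit_plength[OF p] by blast
  qed
  then have "x = d" "y = pcomp (ppow p s) d"
    using e plength_0_pran by (metis pcomp_empty_left)+
  moreover have "Elt (pcomp (pdom p, []) (pcomp (ppow p 0) d)) (pcomp (pdom p, []) (pcomp (ppow p s) d))
      \<in> cycle_subsemigroup G p d"
    using psuffixI[OF pp empty_path[OF pp]] p
    by (intro cycle_subsemigroup_memI1) (simp add: pcomp_empty_right)
  ultimately show ?thesis using d by simp
qed

text \<open>Copies of \<open>p\<close> are stripped from \<open>e\<close>. When both exponents are
  positive, either \<open>p = eh\<close> and the suffix \<open>h\<close> gives a member of the first
  kind, or \<open>e = ph\<close> and cancelling \<open>p\<close> lowers both exponents; an exponent
  zero is the base case, up to symmetry.\<close>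

lemma Elt_in_cycle_subsemigroup:
  assumes cd: "cycle_data G p d" and "e \<in> paths G" and xy: "x \<in> paths G" "y \<in> paths G"
    and "pran G e = pdom x" "pran G e = pdom y"
    "pcomp e x = pcomp (ppow p r) d" "pcomp e y = pcomp (ppow p s) d"
  shows "Elt x y \<in> cycle_subsemigroup G p d"
  using assms(2,5-)
proof (induction r arbitrary: e s)
  case 0
  then show ?case
    using cycle_subsemigroup_base_case[OF cd, of e x y s] xy cd by (simp add: cycle_data_def)
next
  case (Suc r e s')
  show ?case
  proof (cases s')
    case 0
    then show ?thesis
      using cycle_subsemigroup_base_case[OF cd, of e y x "Suc r"] xy cd Suc.prems
      by (intro cycle_subsemigroup_sym[of y x]) (simp add: cycle_data_def)
  next
    case (Suc s)
    have p: "circuit G p" and d: "d \<in> paths G" "pdom d = pdom p"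
      using cd unfolding cycle_data_def by blast+
    have pp: "p \<in> paths G" using p circuit_paths by blast
    note pr = Suc.prems(4)[simplified] and ps = Suc.prems(5)[unfolded Suc, simplified]
    have t: "pcomp (ppow p r) d \<in> paths G" "pran G p = pdom (pcomp (ppow p r) d)"
      using p d by simp_all
    from Suc.prems(1) xy(1) Suc.prems(2) pp t pr show ?thesis
    proof (cases rule: levi_cases)
      case (1 h)
      have "y = pcomp h (pcomp (ppow p s) d)"
      proof (rule pcomp_left_cancel)
        show "pcomp e y = pcomp e (pcomp h (pcomp (ppow p s) d))"
          using ps 1(4) by (metis pcomp_assoc)
      qed (use 1 Suc.prems in simp)
      moreover have "psuffix G h p" using 1 Suc.prems psuffixI by auto
      ultimately show ?thesis using 1(5) cycle_subsemigroup_memI1 by simp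
    next
      case (2 h)
      have "pcomp h y = pcomp (ppow p s) d"
      proof (rule pcomp_left_cancel)
        show "pcomp p (pcomp h y) = pcomp p (pcomp (ppow p s) d)"
          using ps 2(4) by (metis pcomp_assoc)
      qed (use 2 p d in simp)
      then show ?thesis
        using 2 Suc.prems(2,3) by (intro Suc.IH[of h s]) auto
    qed
  qed
qed

lemma cycle_subsemigroup_eq:
  assumes cd: "cycle_data G p d"
  shows "cycle_closure p d = cycle_subsemigroup G p d"
proof
  show "cycle_closure p d \<subseteq> cycle_subsemigroup G p d"
  proof
    fix h assume h: "h \<in> cycle_closure p d"
    then obtain x y where xy: "h = Elt x y" unfolding cycle_closure_def by blast
    from h[unfolded xy] show "h \<in> cycle_subsemigroup G p d"
      unfolding xy by (rule Elt_cycle_closureE) (rule Elt_in_cycle_subsemigroup[OF cd])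
  qed
  have p: "circuit G p" and d: "d \<in> paths G" "pdom d = pdom p"
    using cd unfolding cycle_data_def by blast+
  show "cycle_subsemigroup G p d \<subseteq> cycle_closure p d"
  proof
    fix h assume "h \<in> cycle_subsemigroup G p d"
    then consider v r s where "psuffix G v p"
        "h = Elt (pcomp v (pcomp (ppow p r) d)) (pcomp v (pcomp (ppow p s) d))"
      | q where "psuffix G q d" "h = Elt q q"
      unfolding cycle_subsemigroup_def by blast
    then show "h \<in> cycle_closure p d"
    proof cases
      case (1 v r s)
      from 1(1) obtain q where q: "q \<in> paths G" "v \<in> paths G" "pran G q = pdom v" "p = pcomp q v"
        by (rule psuffixE)
      have rv: "pran G v = pdom p" using circuit_pran[OF p] q by simp
      have "pcomp q (pcomp v (pcomp (ppow p n) d)) = pcomp (ppow p (Suc n)) d" for n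
        using q(4) by (metis pcomp_assoc ppow.simps(2))
      then show ?thesis unfolding 1(2)
        by (intro Elt_cycle_closureI[where e = q and r = "Suc r" and s = "Suc s"])
          (use q(1-3) p d rv in auto)
    next
      case (2 q)
      from 2(1) obtain e where "e \<in> paths G" "q \<in> paths G" "pran G e = pdom q" "d = pcomp e q"
        by (rule psuffixE)
      then show ?thesis unfolding 2(2)
        by (intro Elt_cycle_closureI[where e = e and r = 0 and s = 0]) (use d in auto)
    qed
  qed
qed

section \<open>Conjugation and equality of cycle closures\<close>

lemma cycle_closure_conj:
  assumes p: "circuit G p" and d: "d \<in> paths G" "pdom d = pdom p"
    and K: "zero_free K" and c: "conj_at a b (cycle_closure p d) K"
  shows "\<exists>k \<in> paths G. pdom k = pdom p \<and> cycle_closure p k = K"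
proof -
  have "Elt a a \<in> cycle_closure p d" using c by (simp add: conj_at_def)
  then obtain e n where e: "a \<in> paths G" "e \<in> paths G" "pran G e = pdom a"
    "pcomp e a = pcomp (ppow p n) d" "pdom e = pdom p" by (rule Elt_cycle_closureE)
  have b: "b \<in> paths G" "pdom b = pdom a"
    using c zero_free_Elt[OF K, of b b] by (auto simp: conj_at_def)
  \<comment> \<open>Replacing \<open>d\<close> by \<open>ea = p^n d\<close> leaves the closure
    unchanged and makes its generators end in \<open>a\<close>. Exchanging this tail for
    \<open>b\<close> suggests \<open>eb\<close> as the new second parameter.\<close>
  define H where "H = cycle_closure p (pcomp e a)"
  have "H = cycle_closure p d" using cycle_closure_ppow[OF p d] e by (simp add: H_def)
  then have H: "zero_free H" and c: "conj_at a b H K"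
    using c zero_free_cycle_closure[OF p d] by simp_all
  have "cycle_closure p (pcomp e b) = K"
  proof (rule cycle_closure_eqI[OF _ K])
    fix v w
    show "Elt v w \<in> cycle_closure p (pcomp e b) \<longleftrightarrow> Elt v w \<in> K"
    proof
      assume "Elt v w \<in> cycle_closure p (pcomp e b)"
      then obtain f r s where f: "v \<in> paths G" "w \<in> paths G" "f \<in> paths G" "pran G f = pdom v"
        "pran G f = pdom w" "pcomp f v = pcomp (ppow p r) (pcomp e b)"
        "pcomp f w = pcomp (ppow p s) (pcomp e b)" by (rule Elt_cycle_closureE)
      have "Elt (pcomp (pcomp (ppow p r) e) a) (pcomp (pcomp (ppow p s) e) a) \<in> H"
        unfolding H_def pcomp_assoc using e(1-3,5)
        by (intro cycle_closure_base[OF p]) simp_all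
      then have "Elt (pcomp (pcomp (ppow p r) e) b) (pcomp (pcomp (ppow p s) e) b) \<in> K"
        by (rule conj_atD[OF c, THEN iffD1, rotated -1]) (use e(1-3,5) p in simp_all)
      then have "Elt (pcomp f v) (pcomp f w) \<in> K" by (simp add: f(6,7))
      then show "Elt v w \<in> K" using zero_free_up[OF K _ f(3,1,2,4)] f(4,5) by simp
    next
      assume "Elt v w \<in> K"
      from conj_at_tail[OF K conj_at_sym[OF c] this] obtain q x y where q: "q \<in> paths G"
        "x \<in> paths G" "y \<in> paths G" "pran G q = pdom v" "pran G x = pdom b" "pran G y = pdom b"
        "pcomp q v = pcomp x b" "pcomp q w = pcomp y b" "Elt (pcomp x a) (pcomp y a) \<in> H" .
      have vw: "v \<in> paths G" "w \<in> paths G" "pdom v = pdom w"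
        using zero_free_Elt[OF K \<open>Elt v w \<in> K\<close>] by auto
      from q(9)[unfolded H_def] obtain f r s where f: "f \<in> paths G" "pran G f = pdom x"
        "pcomp f (pcomp x a) = pcomp (ppow p r) (pcomp e a)"
        "pcomp f (pcomp y a) = pcomp (ppow p s) (pcomp e a)"
        by (rule Elt_cycle_closureE) auto
      \<comment> \<open>Cancelling the tail \<open>a\<close> leaves identities that hold just as
        well after appending \<open>b\<close>.\<close>
      have "pcomp f x = pcomp (ppow p r) e" "pcomp f y = pcomp (ppow p s) e"
        using f(3,4) by (metis pcomp_assoc pcomp_right_cancel)+
      then have "pcomp f (pcomp q v) = pcomp (ppow p r) (pcomp e b)"
        "pcomp f (pcomp q w) = pcomp (ppow p s) (pcomp e b)"
        unfolding q(7,8) by (metis pcomp_assoc)+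
      moreover have "pdom q = pdom x" using arg_cong[OF q(7), of pdom] by simp
      ultimately show "Elt v w \<in> cycle_closure p (pcomp e b)"
        by (intro Elt_cycle_closureI[where e = "pcomp f q" and r = r and s = s])
          (use vw q(1,4) f(1,2) in auto)
    qed
  qed
  then show ?thesis using e b by (intro bexI[of _ "pcomp e b"]) auto
qed

text \<open>Once the tail is cancelled, membership of \<open>(xc,yc)\<close> in the closure of
  \<open>p\<close> and \<open>c\<close> is a condition on \<open>p\<close>, \<open>x\<close> and
  \<open>y\<close> only, the same for \<open>a\<close> and for \<open>b\<close>.\<close>

lemma cycle_closure_conj_at:
  assumes p: "circuit G p" and a: "a \<in> paths G" "pdom a = pdom p" and b: "b \<in> paths G" "pdom b = pdom p"
  shows "conj_at a b (cycle_closure p a) (cycle_closure p b)"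
proof -
  have base: "Elt c c \<in> cycle_closure p c" if "c \<in> paths G" "pdom c = pdom p" for c
    using cycle_closure_base[OF p that, of 0 0] that by simp
  have "Elt (pcomp x c) (pcomp y c) \<in> cycle_closure p c \<longleftrightarrow>
      (\<exists>e \<in> paths G. \<exists>r s. pran G e = pdom x \<and> pran G e = pdom y \<and>
        pcomp e x = ppow p r \<and> pcomp e y = ppow p s)"
    if "c \<in> paths G" "x \<in> paths G" "y \<in> paths G" "pran G x = pdom c" "pran G y = pdom c" for c x y
    using that
    by (simp add: Elt_cycle_closure_iff pcomp_assoc[symmetric] del: pcomp_assoc)
  then show ?thesis using a b base by (simp add: conj_at_def)
qed

lemma cycle_closure_eq_imp_conjugate:
  assumes p: "circuit G p" "d \<in> paths G" "pdom d = pdom p"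
    and q: "circuit G q" "k \<in> paths G" "pdom k = pdom q"
    and eq: "cycle_closure p d = cycle_closure q k"
  shows "conjugate_circuits G p q"
proof -
  \<comment> \<open>The element \<open>(pd,d)\<close> is read in terms of \<open>q\<close> and
    \<open>k\<close>. Its two coordinates differ in length by \<open>|p|\<close>, which is therefore
    a multiple of \<open>|q|\<close>; the claim is general because it is used in both
    directions.\<close>
  have shift: "\<exists>e r s. e \<in> paths G \<and> pran G e = pdom d \<and> pdom e = pdom q \<and>
      pcomp e (pcomp p d) = pcomp (ppow q r) k \<and> pcomp e d = pcomp (ppow q s) k \<and>
      plength p + s * plength q = r * plength q"
    if p: "circuit G p" "d \<in> paths G" "pdom d = pdom p"
      and eq: "cycle_closure p d = cycle_closure q k" for p d q k
  proof -
    have "Elt (pcomp p d) d \<in> cycle_closure p d"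
      using cycle_closure_base[OF p, of 1 0] p by (simp add: pcomp_empty_right)
    then have "Elt (pcomp p d) d \<in> cycle_closure q k" using eq by simp
    then obtain e r s where e: "e \<in> paths G" "pran G e = pdom d" "pdom e = pdom q"
      "pcomp e (pcomp p d) = pcomp (ppow q r) k" "pcomp e d = pcomp (ppow q s) k"
      by (rule Elt_cycle_closureE)
    moreover have "plength p + s * plength q = r * plength q"
      using arg_cong[OF e(4), of plength] arg_cong[OF e(5), of plength] by simp
    ultimately show ?thesis by blast
  qed
  obtain e r s where e: "e \<in> paths G" "pran G e = pdom d" "pdom e = pdom q"
    "pcomp e (pcomp p d) = pcomp (ppow q r) k" "pcomp e d = pcomp (ppow q s) k"
    "plength p + s * plength q = r * plength q"
    using shift[OF p eq] by blast
  obtain r' s' where e': "plength q + s' * plength p = r' * plength p"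
    using shift[OF q eq[symmetric]] by blast
  have "plength q dvd plength p" using e(6) by (metis dvd_add_left_iff dvd_triv_right)
  moreover have "plength p dvd plength q" using e' by (metis dvd_add_left_iff dvd_triv_right)
  ultimately have "plength p = plength q" by (simp add: dvd_antisym)
  then have "Suc s * plength q = r * plength q" using e(6) by simp
  then have r: "r = Suc s" using circuit_plength[OF q(1)] by (metis mult_right_cancel less_not_refl)
  \<comment> \<open>Since \<open>r = Suc s\<close>, one further \<open>q\<close> in front of
    \<open>ed = q^s k\<close> gives \<open>epd\<close>; cancelling \<open>d\<close> yields
    \<open>qe = ep\<close>.\<close>
  have "pcomp (pcomp q e) d = pcomp (pcomp e p) d"
    using e(4,5) r by simp
  then have "pcomp q e = pcomp e p" by (simp only: pcomp_right_cancel)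
  then show ?thesis
    using intertwined_circuits_conjugate[OF p(1) q(1) e(1)] e(2,3) p q by simp
qed

text \<open>Normalization supplies parameters that satisfy \<open>cycle_data\<close>, and the
  absence of zero supplies properness.\<close>

lemma cycle_type_iff:
  "cycle_type G L \<longleftrightarrow>
    (\<exists>p d. circuit G p \<and> d \<in> paths G \<and> pdom d = pdom p \<and> L = cycle_closure p d)"
proof
  assume "cycle_type G L"
  then obtain p d where pd: "cycle_data G p d" "L = cycle_subsemigroup G p d"
    unfolding cycle_type_def by blast
  then show "\<exists>p d. circuit G p \<and> d \<in> paths G \<and> pdom d = pdom p \<and> L = cycle_closure p d"
    using cycle_subsemigroup_eq[OF pd(1)] unfolding cycle_data_def by metis
next
  assume "\<exists>p d. circuit G p \<and> d \<in> paths G \<and> pdom d = pdom p \<and> L = cycle_closure p d"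
  then obtain p d where *: "circuit G p" "d \<in> paths G" "pdom d = pdom p" "L = cycle_closure p d"
    by blast
  then show "cycle_type G L"
    using cycle_closure_normalize[OF *(1-3)] cycle_subsemigroup_eq zero_free_cycle_closure
    unfolding cycle_type_def proper_iff_zero_free by metis
qed

lemma cycle_type_conj:
  assumes L: "cycle_type G L" and K: "closed_inverse_subsemigroup gis K" and c: "sg_conjugate gis L K"
  shows "cycle_type G K"
proof -
  obtain p d where pd: "circuit G p" "d \<in> paths G" "pdom d = pdom p" "L = cycle_closure p d"
    using L unfolding cycle_type_iff by blast
  obtain a b where "zero_free K" "conj_at a b L K"
    using conjugate_imp_conj_at[OF _ K c] pd zero_free_cycle_closure by metis
  then show ?thesis unfolding cycle_type_iff using cycle_closure_conj pd by metis
qed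

lemma cycle_subsemigroup_conjugate_iff:
  assumes "cycle_data G p d" "cycle_data G q k"
  shows "sg_conjugate gis (cycle_subsemigroup G p d) (cycle_subsemigroup G q k) \<longleftrightarrow>
    conjugate_circuits G p q"
proof -
  have p: "circuit G p" "d \<in> paths G" "pdom d = pdom p"
    and q: "circuit G q" "k \<in> paths G" "pdom k = pdom q"
    using assms unfolding cycle_data_def by blast+
  note zp = zero_free_cycle_closure[OF p] and zq = zero_free_cycle_closure[OF q]
  have "sg_conjugate gis (cycle_closure p d) (cycle_closure q k) \<longleftrightarrow> conjugate_circuits G p q"
  proof
    assume "sg_conjugate gis (cycle_closure p d) (cycle_closure q k)"
    then obtain a b where "conj_at a b (cycle_closure p d) (cycle_closure q k)"
      using conjugate_imp_conj_at[OF zp] zq by (metis zero_free_def)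
    \<comment> \<open>The conjugate is also a closure over the circuit \<open>p\<close>, so an
      equality between closures over \<open>p\<close> and \<open>q\<close> remains to be
      analysed.\<close>
    then obtain k' where "k' \<in> paths G" "pdom k' = pdom p" "cycle_closure p k' = cycle_closure q k"
      using cycle_closure_conj[OF p zq] by blast
    then show "conjugate_circuits G p q" using cycle_closure_eq_imp_conjugate p(1) q by blast
  next
    assume "conjugate_circuits G p q"
    then obtain u v where uv: "u \<in> paths G" "v \<in> paths G" "pran G u = pdom v" "p = pcomp u v"
      "pran G v = pdom u" "q = pcomp v u"
      unfolding conjugate_circuits_def factors_def by blast
    \<comment> \<open>Rotation expresses the second set over \<open>p\<close> as well; the two sets
      then differ only in their tails, which are exchanged by the pair
      \<open>(d,uk)\<close>.\<close>
    have "cycle_closure q k = cycle_closure p (pcomp u k)"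
      using cycle_closure_rotate[of u v k] uv p q by simp
    moreover have "conj_at d (pcomp u k) (cycle_closure p d) (cycle_closure p (pcomp u k))"
      using cycle_closure_conj_at[OF p, of "pcomp u k"] uv q by simp
    ultimately show "sg_conjugate gis (cycle_closure p d) (cycle_closure q k)"
      using conj_at_imp_conjugate zp zq by simp
  qed
  then show ?thesis using assms cycle_subsemigroup_eq by simp
qed

end

theorem theorem3p6:
  fixes G :: "('a, 'b) pre_digraph"
  assumes "fin_digraph G"
  shows
    "(\<forall>L K. finite_chain_type (graph_inverse_semigroup G) L \<and> closed_inverse_subsemigroup (graph_inverse_semigroup G) K \<and> sg_conjugate (graph_inverse_semigroup G) L K
        \<longrightarrow> finite_chain_type (graph_inverse_semigroup G) K) \<and>
     (\<forall>u \<in> paths G. \<forall>v \<in> paths G.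
        sg_conjugate (graph_inverse_semigroup G) (up_path G u) (up_path G v)
        \<longleftrightarrow> chain_root G (up_path G u) = chain_root G (up_path G v)) \<and>
     (\<forall>L K. infinite_chain_type (graph_inverse_semigroup G) L \<and> closed_inverse_subsemigroup (graph_inverse_semigroup G) K \<and> sg_conjugate (graph_inverse_semigroup G) L K
        \<longrightarrow> infinite_chain_type (graph_inverse_semigroup G) K) \<and>
     (\<forall>L K. infinite_chain_type (graph_inverse_semigroup G) L \<and> infinite_chain_type (graph_inverse_semigroup G) K \<longrightarrow>
        (sg_conjugate (graph_inverse_semigroup G) L K \<longleftrightarrow>
          (\<exists>s t. Elt s s \<in> L \<and> Elt t t \<in> K \<and>
             (\<forall>p \<in> paths G.
                (pran G p = pdom s \<and> Elt (pcomp p s) (pcomp p s) \<in> L) \<longleftrightarrow>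
                (pran G p = pdom t \<and> Elt (pcomp p t) (pcomp p t) \<in> K))))) \<and>
     (\<forall>L K. cycle_type G L \<and> closed_inverse_subsemigroup (graph_inverse_semigroup G) K \<and> sg_conjugate (graph_inverse_semigroup G) L K
        \<longrightarrow> cycle_type G K) \<and>
     (\<forall>p d q k. cycle_data G p d \<and> cycle_data G q k \<longrightarrow>
        (sg_conjugate (graph_inverse_semigroup G) (cycle_subsemigroup G p d) (cycle_subsemigroup G q k)
         \<longleftrightarrow> conjugate_circuits G p q))"
proof -
  interpret fin_digraph G by fact
  show ?thesis
  proof (intro conjI allI ballI impI)
    fix u v assume "u \<in> paths G" "v \<in> paths G"
    then show "sg_conjugate gis (up_path G u) (up_path G v) \<longleftrightarrow>
        chain_root G (up_path G u) = chain_root G (up_path G v)"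
      by (simp only: up_path_conjugate_iff chain_root_up_path)
  qed (elim conjE; rule finite_chain_type_conj infinite_chain_type_conj infinite_chain_conjugate_iff
    cycle_type_conj cycle_subsemigroup_conjugate_iff; assumption)+
qed

end
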